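(* Let $f,g:\mathbb{R}^n\to[0,+\infty)$ and $h_1,h_2:\mathbb{R}^n\to\mathbb{R}$, let $C\subseteq\mathbb{R}^n$ be closed and convex, $\Omega:=\{x:g(x)\neq0\}$, $C\cap\Omega\neq\emptyset$, and assume: $f$ is convex; $g$ is differentiable with locally Lipschitz gradient; $h_1$ is differentiable with locally Lipschitz gradient; $h_2$ is convex. Let $F$, $H$ and Algorithm 1 be as in the context, with $x^0\in\mathrm{dom}F$, and assume $\mathcal{X}_0:=\{x\in\mathrm{dom}F:F(x)\le F(x^0)\}$ is compact. If $H$ is a proper closed KL function, then the whole sequence $\{x^k:k\in\mathbb{N}\}$ generated by Algorithm 1 converges to a critical point of $F$.
   Context: $F(x)=f^2(x)/g(x)+h_1(x)-h_2(x)$ if $x\in\Omega\cap C$, $F(x)=+\infty$ otherwise. $\iota_C$ is the indicator of $C$, $h_2^\star$ the convex conjugate of $h_2$, $\partial$ the limiting subdifferential, $\mathrm{prox}_\varphi(y)=\arg\min_x\{\varphi(x)+\frac12\|x-y\|_2^2\}$. $H(x,z,c)=2cf(x)+\iota_C(x)-c^2g(x)+h_1(x)+h_2^\star(z)-\langle x,z\rangle$. A point $x^\star\in\Omega\cap C$ is a critical point of $F$ if, with $c_\star=f(x^\star)/g(x^\star)$, $0\in\partial(2c_\star f+\iota_C)(x^\star)-c_\star^2\nabla g(x^\star)+\nabla h_1(x^\star)-\partial h_2(x^\star)$. KL property: a proper $\varphi$ satisfies it at $\widehat{x}\in\mathrm{dom}\,\partial\varphi$ if there are $a\in(0,+\infty]$,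 a neighborhood $U$ of $\widehat{x}$ and a continuous concave $\phi:[0,a)\to[0,+\infty)$ with $\phi(0)=0$, $\phi$ continuously differentiable on $(0,a)$ with $\phi'>0$ there, such that $\phi'(\varphi(x)-\varphi(\widehat{x}))\,\mathrm{dist}(0,\partial\varphi(x))\ge1$ for all $x\in U$ with $\varphi(\widehat{x})<\varphi(x)<\varphi(\widehat{x})+a$. A KL function satisfies the KL property at every point of $\mathrm{dom}\,\partial\varphi$. Algorithm 1: given $x^0\in\mathrm{dom}F$, $0<\underline{\alpha}<\overline{\alpha}$, $\sigma>0$, $0<r<1$, for $k=0,1,2,\dots$: (Step 1) compute $c_k=f(x^k)/g(x^k)$, choose $z^k\in\partial h_2(x^k)$, set $\alpha:=\widetilde{\alpha}_k\in[\underline{\alpha},\overline{\alpha}]$; (Step 2) compute $\widehat{x}^k\in\mathrm{prox}_{2\alpha c_kf+\iota_C}\big(x^k-\alpha(\nabla h_1(x^k)-c_k^2\nabla g(x^k)-z^k)\big)$; if $\widehat{x}^k\in\Omega$ and $H(\widehat{x}^k,z^k,f(\widehat{x}^k)/g(\widehat{x}^k))+\frac{\sigma}{2}\|\widehat{x}^k-x^k\|_2^2\le F(x^k)$, set $x^{k+1}=\widehat{x}^k$, $\alpha_k:=\alpha$ and go to the next $k$; otherwise set $\alpha:=r\alpha$ and repeat Step 2. *)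

theory Defs
  imports "HOL-Analysis.Analysis"
begin

text \<open>Frechet (regular) subdifferential, written out from the liminf definition.\<close>
definition fsubdiff :: "('a::euclidean_space \<Rightarrow> ereal) \<Rightarrow> 'a \<Rightarrow> 'a set" where
  "fsubdiff \<phi> x = {v. \<bar>\<phi> x\<bar> \<noteq> \<infinity> \<and>
     (\<forall>\<epsilon>>0. \<exists>\<delta>>0. \<forall>y. norm (y - x) < \<delta> \<longrightarrow>
        \<phi> x + ereal (inner v (y - x) - \<epsilon> * norm (y - x)) \<le> \<phi> y)}"

definition lsubdiff :: "('a::euclidean_space \<Rightarrow> ereal) \<Rightarrow> 'a \<Rightarrow> 'a set" where
  "lsubdiff \<phi> x = {v. \<bar>\<phi> x\<bar> \<noteq> \<infinity> \<and>
     (\<exists>xs vs. xs \<longlonglongrightarrow> x \<and> (\<lambda>k. \<phi> (xs k)) \<longlonglongrightarrow> \<phi> x \<and>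
        (\<forall>k. vs k \<in> fsubdiff \<phi> (xs k)) \<and> vs \<longlonglongrightarrow> v)}"

definition proper_fun :: "('a \<Rightarrow> ereal) \<Rightarrow> bool" where
  "proper_fun \<phi> \<longleftrightarrow> (\<forall>x. \<phi> x \<noteq> -\<infinity>) \<and> (\<exists>x. \<phi> x \<noteq> \<infinity>)"

definition closed_fun :: "('a::topological_space \<Rightarrow> ereal) \<Rightarrow> bool" where
  "closed_fun \<phi> \<longleftrightarrow> closed {(x, t::real). \<phi> x \<le> ereal t}"

text \<open>KL property at a point of dom of the limiting subdifferential.
  dist(0, empty set) is taken as +infinity, so points with empty subdifferential
  satisfy the inequality trivially.\<close>
definition KL_at :: "('a::euclidean_space \<Rightarrow> ereal) \<Rightarrow> 'a \<Rightarrow> bool" where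
  "KL_at \<phi> xh \<longleftrightarrow> lsubdiff \<phi> xh \<noteq> {} \<and>
    (\<exists>a::ereal. a > 0 \<and> (\<exists>U \<psi> \<psi>'. open U \<and> xh \<in> U \<and>
       continuous_on {s. 0 \<le> s \<and> ereal s < a} \<psi> \<and>
       concave_on {s. 0 \<le> s \<and> ereal s < a} \<psi> \<and>
       \<psi> 0 = 0 \<and>
       (\<forall>s. 0 \<le> s \<and> ereal s < a \<longrightarrow> 0 \<le> \<psi> s) \<and>
       (\<forall>s. 0 < s \<and> ereal s < a \<longrightarrow> (\<psi> has_real_derivative \<psi>' s) (at s) \<and> \<psi>' s > 0) \<and>
       continuous_on {s. 0 < s \<and> ereal s < a} \<psi>' \<and>
       (\<forall>x\<in>U. \<phi> xh < \<phi> x \<and> \<phi> x < \<phi> xh + a \<longrightarrow>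
          lsubdiff \<phi> x = {} \<or>
          1 \<le> \<psi>' (real_of_ereal (\<phi> x - \<phi> xh)) * infdist 0 (lsubdiff \<phi> x))))"

definition KL_function :: "('a::euclidean_space \<Rightarrow> ereal) \<Rightarrow> bool" where
  "KL_function \<phi> \<longleftrightarrow> (\<forall>x. lsubdiff \<phi> x \<noteq> {} \<longrightarrow> KL_at \<phi> x)"

definition prox :: "('a::euclidean_space \<Rightarrow> ereal) \<Rightarrow> 'a \<Rightarrow> 'a set" where
  "prox \<phi> y = {x. \<phi> x \<noteq> \<infinity> \<and>
     (\<forall>w. \<phi> x + ereal (norm (x - y)^2 / 2) \<le> \<phi> w + ereal (norm (w - y)^2 / 2))}"

definition conjugate :: "('a::real_inner \<Rightarrow> real) \<Rightarrow> 'a \<Rightarrow> ereal" where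
  "conjugate h z = (SUP x. ereal (inner x z - h x))"

definition locally_lipschitz :: "('a::metric_space \<Rightarrow> 'b::metric_space) \<Rightarrow> bool" where
  "locally_lipschitz F \<longleftrightarrow> (\<forall>x. \<exists>U L. open U \<and> x \<in> U \<and>
      (\<forall>y\<in>U. \<forall>w\<in>U. dist (F y) (F w) \<le> L * dist y w))"

definition Omega :: "('n \<Rightarrow> real) \<Rightarrow> 'n set" where
  "Omega g = {x. g x \<noteq> 0}"

definition indicator_plus :: "'a set \<Rightarrow> ('a \<Rightarrow> real) \<Rightarrow> 'a \<Rightarrow> ereal" where
  "indicator_plus C \<phi> x = (if x \<in> C then ereal (\<phi> x) else \<infinity>)"

definition Ffun :: "('n \<Rightarrow> real) \<Rightarrow> ('n \<Rightarrow> real) \<Rightarrow> ('n \<Rightarrow> real) \<Rightarrow> ('n \<Rightarrow> real)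
     \<Rightarrow> 'n set \<Rightarrow> 'n \<Rightarrow> ereal" where
  "Ffun f g h1 h2 C x = (if x \<in> Omega g \<inter> C then ereal ((f x)^2 / g x + h1 x - h2 x) else \<infinity>)"

definition Hfun :: "('n::real_inner \<Rightarrow> real) \<Rightarrow> ('n \<Rightarrow> real) \<Rightarrow> ('n \<Rightarrow> real) \<Rightarrow> ('n \<Rightarrow> real)
     \<Rightarrow> 'n set \<Rightarrow> 'n \<times> 'n \<times> real \<Rightarrow> ereal" where
  "Hfun f g h1 h2 C = (\<lambda>(x, z, c).
     indicator_plus C (\<lambda>y. 2 * c * f y - c^2 * g y + h1 y - inner y z) x + conjugate h2 z)"

definition critical_point :: "('n::euclidean_space \<Rightarrow> real) \<Rightarrow> ('n \<Rightarrow> real) \<Rightarrow> ('n \<Rightarrow> real)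
     \<Rightarrow> ('n \<Rightarrow> real) \<Rightarrow> ('n \<Rightarrow> 'n) \<Rightarrow> ('n \<Rightarrow> 'n) \<Rightarrow> 'n set \<Rightarrow> 'n \<Rightarrow> bool" where
  "critical_point f g h1 h2 Dg Dh1 C xs \<longleftrightarrow> xs \<in> Omega g \<inter> C \<and>
     (let c = f xs / g xs in
       \<exists>u \<in> lsubdiff (indicator_plus C (\<lambda>y. 2 * c * f y)) xs.
       \<exists>w \<in> lsubdiff (\<lambda>y. ereal (h2 y)) xs.
         u - c^2 *\<^sub>R Dg xs + Dh1 xs - w = 0)"

text \<open>Sequences generated by Algorithm 1: at iteration k, z is the chosen
  subgradient, at the initial trial step size, and j the number of backtracking
  reductions; all trials i < j computed a prox point that was rejected, and the
  trial with step r^j * at is accepted and gives x (k+1).\<close>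
definition alg1_seq :: "('n::euclidean_space \<Rightarrow> real) \<Rightarrow> ('n \<Rightarrow> real) \<Rightarrow> ('n \<Rightarrow> real)
     \<Rightarrow> ('n \<Rightarrow> real) \<Rightarrow> ('n \<Rightarrow> 'n) \<Rightarrow> ('n \<Rightarrow> 'n) \<Rightarrow> 'n set
     \<Rightarrow> real \<Rightarrow> real \<Rightarrow> real \<Rightarrow> real \<Rightarrow> 'n \<Rightarrow> (nat \<Rightarrow> 'n) \<Rightarrow> bool" where
  "alg1_seq f g h1 h2 Dg Dh1 C alo ahi \<sigma> r x0 x \<longleftrightarrow> x 0 = x0 \<and>
    (\<forall>k. \<exists>z a0 j. (
       let c = f (x k) / g (x k);
           y = (\<lambda>\<alpha>. x k - \<alpha> *\<^sub>R (Dh1 (x k) - c^2 *\<^sub>R Dg (x k) - z));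
           \<phi> = (\<lambda>\<alpha>. indicator_plus C (\<lambda>w. 2 * \<alpha> * c * f w));
           acc = (\<lambda>xh. xh \<in> Omega g \<and>
                    Hfun f g h1 h2 C (xh, z, f xh / g xh) + ereal (\<sigma> / 2 * (norm (xh - x k))^2)
                      \<le> Ffun f g h1 h2 C (x k))
       in z \<in> lsubdiff (\<lambda>w. ereal (h2 w)) (x k) \<and> alo \<le> a0 \<and> a0 \<le> ahi \<and>
          (\<forall>i<j. \<exists>xh \<in> prox (\<phi> (r^i * a0)) (y (r^i * a0)). \<not> acc xh) \<and>
          x (Suc k) \<in> prox (\<phi> (r^j * a0)) (y (r^j * a0)) \<and> acc (x (Suc k))))"

end

theory Submission
  imports Defs
begin

text \<open>
  With \<open>c = f/g\<close> the surrogate \<open>H\<close> satisfies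
  \<open>F (x\<^sup>k\<^sup>+\<^sup>1) \<le> H (w\<^sup>k\<^sup>+\<^sup>1) \<le> F (x\<^sup>k) - \<sigma>/2 * |x\<^sup>k\<^sup>+\<^sup>1 - x\<^sup>k|\<^sup>2\<close> for
  \<open>w\<^sup>k\<^sup>+\<^sup>1 = (x\<^sup>k\<^sup>+\<^sup>1, z\<^sup>k, c\<^sub>k\<^sub>+\<^sub>1)\<close>, so \<open>F (x\<^sup>k)\<close> and \<open>H (w\<^sup>k)\<close> decrease to a common
  limit. The linear model of \<open>f\<^sup>2/g + h\<^sub>1\<close> is accurate to second order uniformly near the compact
  sublevel set, hence backtracking keeps the step sizes away from 0. The optimality condition of the
  prox step is the first component of a subgradient of \<open>H\<close> at \<open>w\<^sup>k\<^sup>+\<^sup>1\<close> once \<open>c\<^sub>k\<close> is replaced by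
  \<open>c\<^sub>k\<^sub>+\<^sub>1\<close>; splitting \<open>\<partial>(2cf + \<iota>)\<close> by the convex sum rule makes that replacement cost
  \<open>O(|x\<^sup>k\<^sup>+\<^sup>1 - x\<^sup>k|)\<close>, even when \<open>c\<^sub>k = 0\<close>. The KL inequality, made uniform over the compact range of the
  states because \<open>z\<^sup>k\<close> need not converge, then yields summable steps.
\<close>

section \<open>Convex analysis: global subgradients over a set\<close>

section \<open>Convex subgradients\<close>

text \<open>For \<open>x\<close> in \<open>C\<close> and zero \<open>\<phi>\<close> this is the
  normal cone; for \<open>C = UNIV\<close> it is the convex subdifferential. One real-valued notion
  covers \<open>f\<close>, \<open>h2\<close>, the constrained multiple of \<open>f\<close> and the
  normals.\<close>

definition subgrads :: "'a::real_inner set \<Rightarrow> ('a \<Rightarrow> real) \<Rightarrow> 'a \<Rightarrow> 'a set" where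
  "subgrads C \<phi> x = {u. \<forall>y\<in>C. \<phi> x + inner u (y - x) \<le> \<phi> y}"

lemma subgradsD: "u \<in> subgrads C \<phi> x \<Longrightarrow> y \<in> C \<Longrightarrow> \<phi> x + inner u (y - x) \<le> \<phi> y"
  by (simp add: subgrads_def)

text \<open>Dividing by \<open>t\<close> and letting \<open>t\<close> tend to 0 removes the
  quadratic term; this extracts first-order conditions from minimality along a segment.\<close>

lemma nonneg_if_nonneg_along_segment:
  fixes a b :: real
  assumes "\<And>t. 0 < t \<Longrightarrow> t \<le> 1 \<Longrightarrow> 0 \<le> t * a + t\<^sup>2 * b"
  shows "0 \<le> a"
proof (rule ccontr)
  assume n: "\<not> 0 \<le> a"
  define t where "t = min 1 (- a / (2 * (\<bar>b\<bar> + 1)))"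
  have t: "0 < t" "t \<le> 1" using n by (auto simp: t_def divide_less_0_iff)
  have "t * (\<bar>b\<bar> + 1) \<le> (- a / (2 * (\<bar>b\<bar> + 1))) * (\<bar>b\<bar> + 1)"
    by (intro mult_right_mono) (auto simp: t_def)
  also have "\<dots> = - a / 2" by (simp add: field_simps)
  finally have "t * (\<bar>b\<bar> + 1) \<le> - a / 2" .
  moreover have "t * b \<le> t * (\<bar>b\<bar> + 1)" using t by (intro mult_left_mono) auto
  ultimately have "a + t * b < 0" using n by linarith
  then have "t * (a + t * b) < 0" using t by (simp add: mult_pos_neg)
  then show False using assms[OF t] by (simp add: power2_eq_square algebra_simps)
qed

lemma fsubdiff_subset_lsubdiff: "fsubdiff \<phi> x \<subseteq> lsubdiff \<phi> x"
proof
  fix v assume "v \<in> fsubdiff \<phi> x"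
  then show "v \<in> lsubdiff \<phi> x"
    unfolding lsubdiff_def mem_Collect_eq
    by (intro conjI exI[of _ "\<lambda>_. x"] exI[of _ "\<lambda>_. v"]) (auto simp: fsubdiff_def)
qed

lemma subgrads_subset_fsubdiff:
  assumes "x \<in> C"
  shows "subgrads C \<phi> x \<subseteq> fsubdiff (indicator_plus C \<phi>) x"
proof
  fix u assume u: "u \<in> subgrads C \<phi> x"
  have "indicator_plus C \<phi> x + ereal (inner u (y - x) - \<epsilon> * norm (y - x)) \<le> indicator_plus C \<phi> y"
    if "\<epsilon> > 0" for \<epsilon> :: real and y
  proof (cases "y \<in> C")
    case True
    have "0 \<le> \<epsilon> * norm (y - x)" using that by simp
    then have "\<phi> x + (inner u (y - x) - \<epsilon> * norm (y - x)) \<le> \<phi> y"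
      using subgradsD[OF u True] by linarith
    then show ?thesis using True assms by (simp add: indicator_plus_def)
  qed (simp add: indicator_plus_def)
  then show "u \<in> fsubdiff (indicator_plus C \<phi>) x"
    using assms by (auto simp: fsubdiff_def indicator_plus_def intro!: exI[of _ "1::real"])
qed

lemma subgrads_subset_lsubdiff:
  assumes "x \<in> C"
  shows "subgrads C \<phi> x \<subseteq> lsubdiff (indicator_plus C \<phi>) x"
  using subgrads_subset_fsubdiff[OF assms] fsubdiff_subset_lsubdiff by blast

lemma convex_on_line_diff:
  assumes "convex_on C \<phi>" "x \<in> C" "y \<in> C" "0 \<le> t" "t \<le> 1"
  shows "\<phi> (x + t *\<^sub>R (y - x)) - \<phi> x \<le> t * (\<phi> y - \<phi> x)"
proof -
  have "\<phi> ((1 - t) *\<^sub>R x + t *\<^sub>R y) \<le> (1 - t) * \<phi> x + t * \<phi> y"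
    using assms by (intro convex_onD) auto
  moreover have "(1 - t) *\<^sub>R x + t *\<^sub>R y = x + t *\<^sub>R (y - x)" by (simp add: algebra_simps)
  ultimately show ?thesis by (simp add: algebra_simps)
qed

text \<open>A Frechet inequality holds only near \<open>x\<close>, but convexity bounds the
  increment on a short piece of the segment by the scaled increment at \<open>y\<close>, so the
  inequality becomes global.\<close>

lemma fsubdiff_convex:
  fixes \<phi> :: "'a::euclidean_space \<Rightarrow> real"
  assumes "convex_on UNIV \<phi>"
  shows "fsubdiff (\<lambda>w. ereal (\<phi> w)) x \<subseteq> subgrads UNIV \<phi> x"
proof
  fix v assume v: "v \<in> fsubdiff (\<lambda>w. ereal (\<phi> w)) x"
  have "\<phi> x + inner v (y - x) \<le> \<phi> y" for y
  proof (rule field_le_epsilon)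
    fix e :: real assume e: "e > 0"
    \<comment> \<open>Scaled so that the Frechet error at \<open>y\<close> itself is at most
      \<open>e\<close>.\<close>
    define \<epsilon> where "\<epsilon> = e / (norm (y - x) + 1)"
    have "\<epsilon> > 0" using e by (simp add: \<epsilon>_def add_nonneg_pos)
    then obtain \<delta> where \<delta>: "\<delta> > 0"
      "\<And>w. norm (w - x) < \<delta> \<Longrightarrow> \<phi> x + (inner v (w - x) - \<epsilon> * norm (w - x)) \<le> \<phi> w"
      using v unfolding fsubdiff_def by auto
    \<comment> \<open>Short enough for \<open>x + t *\<^sub>R (y - x)\<close> to be within distance
      \<open>\<delta>\<close> of \<open>x\<close>.\<close>
    define t where "t = min 1 (\<delta> / (2 * (norm (y - x) + 1)))"
    have t: "0 < t" "t \<le> 1" using \<delta> by (auto simp: t_def add_nonneg_pos)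
    have "t * norm (y - x) \<le> (\<delta> / (2 * (norm (y - x) + 1))) * (norm (y - x) + 1)"
      using \<delta>(1) by (intro mult_mono) (auto simp: t_def)
    also have "\<dots> = \<delta> / 2"
    proof -
      have "norm (y - x) + 1 \<noteq> 0" by (smt (verit) norm_ge_zero)
      then show ?thesis by (simp add: field_simps)
    qed
    also have "\<dots> < \<delta>" using \<delta> by simp
    finally have "norm ((x + t *\<^sub>R (y - x)) - x) < \<delta>" using t by simp
    from \<delta>(2)[OF this] have "t * (inner v (y - x) - \<epsilon> * norm (y - x)) \<le> \<phi> (x + t *\<^sub>R (y - x)) - \<phi> x"
      using t by (simp add: right_diff_distrib mult.left_commute)
    also have "\<dots> \<le> t * (\<phi> y - \<phi> x)" using t by (intro convex_on_line_diff[OF assms]) auto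
    finally have "inner v (y - x) - \<epsilon> * norm (y - x) \<le> \<phi> y - \<phi> x" using t by simp
    moreover have "\<epsilon> * norm (y - x) \<le> e"
    proof -
      have "norm (y - x) + 1 > 0" by (smt (verit) norm_ge_zero)
      then show ?thesis using e by (simp add: \<epsilon>_def field_simps)
    qed
    ultimately show "\<phi> x + inner v (y - x) \<le> \<phi> y + e" by linarith
  qed
  then show "v \<in> subgrads UNIV \<phi> x" by (simp add: subgrads_def)
qed

text \<open>The functions vary with \<open>k\<close> because the coefficient of \<open>f\<close>
  changes along the iterates; with constant functions this is closedness of the subdifferential
  graph.\<close>

lemma subgrads_closed:
  assumes u: "us \<longlonglongrightarrow> u" and x: "xs \<longlonglongrightarrow> x" and y: "(\<lambda>k. \<phi>s k (xs k)) \<longlonglongrightarrow> \<phi> x"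
    and lim: "\<And>y. y \<in> C \<Longrightarrow> (\<lambda>k. \<phi>s k y) \<longlonglongrightarrow> \<phi> y"
    and sub: "\<And>k. us k \<in> subgrads C (\<phi>s k) (xs k)"
  shows "u \<in> subgrads C \<phi> x"
  unfolding subgrads_def
proof safe
  fix y assume "y \<in> C"
  have "(\<lambda>k. \<phi>s k (xs k) + inner (us k) (y - xs k)) \<longlonglongrightarrow> \<phi> x + inner u (y - x)"
    by (intro tendsto_add y tendsto_inner u tendsto_diff tendsto_const x)
  then show "\<phi> x + inner u (y - x) \<le> \<phi> y"
    using lim[OF \<open>y \<in> C\<close>]
    by (rule LIMSEQ_le) (intro exI allI impI subgradsD[OF sub \<open>y \<in> C\<close>])
qed

text \<open>The approximating Frechet subgradients are global ones, which pass to the limit. Hence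
  each \<open>z\<close> chosen by the algorithm is the slope of an affine minorant of
  \<open>h2\<close>.\<close>

lemma lsubdiff_convex:
  fixes \<phi> :: "'a::euclidean_space \<Rightarrow> real"
  assumes "convex_on UNIV \<phi>"
  shows "lsubdiff (\<lambda>w. ereal (\<phi> w)) x = subgrads UNIV \<phi> x"
proof
  show "lsubdiff (\<lambda>w. ereal (\<phi> w)) x \<subseteq> subgrads UNIV \<phi> x"
  proof
    fix v assume "v \<in> lsubdiff (\<lambda>w. ereal (\<phi> w)) x"
    then obtain xs vs where xs: "xs \<longlonglongrightarrow> x" "(\<lambda>k. \<phi> (xs k)) \<longlonglongrightarrow> \<phi> x" "vs \<longlonglongrightarrow> v"
      and vs: "\<And>k. vs k \<in> fsubdiff (\<lambda>w. ereal (\<phi> w)) (xs k)"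
      unfolding lsubdiff_def by auto
    show "v \<in> subgrads UNIV \<phi> x"
      by (rule subgrads_closed[where \<phi>s = "\<lambda>_. \<phi>", OF xs(3,1,2) tendsto_const])
        (rule subsetD[OF fsubdiff_convex[OF assms] vs])
  qed
  have "(\<lambda>w. ereal (\<phi> w)) = indicator_plus UNIV \<phi>" by (auto simp: indicator_plus_def)
  then show "subgrads UNIV \<phi> x \<subseteq> lsubdiff (\<lambda>w. ereal (\<phi> w)) x"
    using subgrads_subset_lsubdiff[of x UNIV \<phi>] by simp
qed

text \<open>The sum rule comes from separating the strict epigraph of the gap
  \<open>\<phi> y - \<phi> x - \<langle>u, y - x\<rangle>\<close> from \<open>C \<times> (-\<infinity>, 0]\<close>; the hyperplane is not
  vertical because \<open>\<phi>\<close> is finite everywhere.\<close>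
lemma subgrads_sum_rule:
  fixes \<phi> :: "'a::euclidean_space \<Rightarrow> real"
  assumes conv: "convex_on UNIV \<phi>" and C: "convex C" "x \<in> C" and u: "u \<in> subgrads C \<phi> x"
  obtains \<xi> where "\<xi> \<in> subgrads UNIV \<phi> x" "u - \<xi> \<in> subgrads C (\<lambda>_. 0) x"
proof -
  define G where "G y = \<phi> y - \<phi> x - inner u (y - x)" for y
  have Gx: "G x = 0" by (simp add: G_def)
  have GC: "G y \<ge> 0" if "y \<in> C" for y using subgradsD[OF u that] by (simp add: G_def)
  have Gconv: "G (s *\<^sub>R y + t *\<^sub>R w) \<le> s * G y + t * G w"
    if "0 \<le> s" "0 \<le> t" "s + t = 1" for s t y w
  proof -
    have "\<phi> (s *\<^sub>R y + t *\<^sub>R w) \<le> s * \<phi> y + t * \<phi> w"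
      using conv that by (auto simp: convex_on_def)
    moreover have "inner u (s *\<^sub>R y + t *\<^sub>R w - x) = s * inner u (y - x) + t * inner u (w - x)"
    proof -
      have "inner u x = (s + t) * inner u x" using that by simp
      then show ?thesis by (simp add: inner_diff_right inner_add_right algebra_simps)
    qed
    moreover have "\<phi> x = s * \<phi> x + t * \<phi> x" using that(3) by (simp flip: distrib_right)
    ultimately show ?thesis by (simp add: G_def algebra_simps)
  qed
  define A where "A = {(y, t). G y < t}"
  define B where "B = C \<times> {..(0::real)}"
  have "convex A"
    unfolding convex_def A_def
  proof (clarsimp)
    fix y t w s p q assume h: "G y < t" "G w < s" "0 \<le> (p::real)" "0 \<le> q" "p + q = 1"
    have "p * G y + q * G w < p * t + q * s"
    proof (cases "p = 0")
      case True then show ?thesis using h by simp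
    next
      case False
      then have "p * G y < p * t" "q * G w \<le> q * s" using h by (auto intro: mult_left_mono)
      then show ?thesis by linarith
    qed
    then show "G (p *\<^sub>R y + q *\<^sub>R w) < p * t + q * s"
      using Gconv[of p q y w] h by linarith
  qed
  moreover have "convex B" unfolding B_def by (intro convex_Times C convex_real_interval)
  moreover have "A \<noteq> {}" "B \<noteq> {}" using Gx C by (auto simp: A_def B_def intro: lt_ex gt_ex)
  moreover have "A \<inter> B = {}" using GC by (fastforce simp: A_def B_def)
  ultimately obtain ab \<gamma> where ab: "ab \<noteq> 0" "\<forall>w\<in>A. inner ab w \<le> \<gamma>" "\<forall>w\<in>B. inner ab w \<ge> \<gamma>"
    using separating_hyperplane_sets[of A B] by auto
  obtain a b where abe: "ab = (a, b)" by fastforce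
  have A: "inner a y + b * t \<le> \<gamma>" if "G y < t" for y t
    using ab(2) that by (auto simp: abe A_def)
  have B: "inner a y \<ge> \<gamma>" if "y \<in> C" for y
    using ab(3) that by (force simp: abe B_def)
  \<comment> \<open>Letting \<open>t\<close> decrease to \<open>G y\<close> carries the separation
    from the strict epigraph to the graph.\<close>
  have A': "inner a y + b * G y \<le> \<gamma>" for y
  proof (rule field_le_epsilon)
    fix e :: real assume "e > 0"
    define d where "d = e / (\<bar>b\<bar> + 1)"
    have d: "d > 0" using \<open>e > 0\<close> by (simp add: d_def add_nonneg_pos)
    have "- (b * d) \<le> \<bar>b\<bar> * d" using mult_right_mono[OF abs_ge_minus_self[of b], of d] d by simp
    also have "\<dots> \<le> (\<bar>b\<bar> + 1) * d" using d by (simp add: algebra_simps)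
    also have "\<dots> = e" unfolding d_def by simp
    finally show "inner a y + b * G y \<le> \<gamma> + e"
      using A[of y "G y + d"] d by (simp add: algebra_simps)
  qed
  have gx: "inner a x = \<gamma>" using A'[of x] B[OF C(2)] Gx by simp
  \<comment> \<open>The epigraph point \<open>(x, 1)\<close> gives \<open>b \<le> 0\<close>; if
    \<open>b = 0\<close>, testing at \<open>x + a\<close> forces \<open>a = 0\<close>, against
    \<open>ab \<noteq> 0\<close>.\<close>
  have "b < 0"
  proof (rule ccontr)
    assume "\<not> b < 0"
    moreover have "b \<le> 0" using A[of x 1] gx Gx by simp
    ultimately have b0: "b = 0" by simp
    have "inner a (x + a) \<le> \<gamma>" using A'[of "x + a"] b0 by simp
    then have "inner a a \<le> 0" using gx by (simp add: inner_add_right)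
    then have "a = 0" by (metis inner_gt_zero_iff not_less)
    then show False using ab(1) b0 by (simp add: abe zero_prod_def)
  qed
  \<comment> \<open>The hyperplane has slope \<open>- (1 / b) *\<^sub>R a\<close>, a subgradient of
    \<open>G\<close> at \<open>x\<close>; adding \<open>u\<close> undoes the tilt in
    \<open>G\<close>.\<close>
  define \<xi> where "\<xi> = u - (1 / b) *\<^sub>R a"
  show thesis
  proof
    show "\<xi> \<in> subgrads UNIV \<phi> x"
      unfolding subgrads_def
    proof safe
      fix y
      have "inner a (y - x) + b * G y \<le> 0" using A'[of y] gx by (simp add: inner_diff_right)
      then have "- (inner a (y - x) / b) \<le> G y" using \<open>b < 0\<close> by (simp add: field_simps)
      then show "\<phi> x + inner \<xi> (y - x) \<le> \<phi> y" by (simp add: G_def \<xi>_def inner_diff_left)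
    qed
    show "u - \<xi> \<in> subgrads C (\<lambda>_. 0) x"
      unfolding subgrads_def
    proof safe
      fix y assume "y \<in> C"
      then have "0 \<le> inner a (y - x)" using B[of y] gx by (simp add: inner_diff_right)
      then show "0 + inner (u - \<xi>) (y - x) \<le> 0"
        using \<open>b < 0\<close> by (simp add: \<xi>_def divide_nonneg_neg)
    qed
  qed
qed

text \<open>On the singleton \<open>{x}\<close> the vector 0 is a subgradient, and the sum rule
  splits an unconstrained one off it.\<close>

lemma subgrads_nonempty:
  fixes \<phi> :: "'a::euclidean_space \<Rightarrow> real"
  assumes "convex_on UNIV \<phi>"
  shows "subgrads UNIV \<phi> x \<noteq> {}"
proof -
  have "0 \<in> subgrads {x} \<phi> x" by (simp add: subgrads_def)
  then obtain \<xi> where "\<xi> \<in> subgrads UNIV \<phi> x"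
    by (rule subgrads_sum_rule[OF assms convex_singleton singletonI])
  then show ?thesis by blast
qed

text \<open>The coefficient may be 0, since \<open>f\<close> may vanish at an iterate: then
  \<open>u\<close> is already normal to \<open>C\<close> and any subgradient of
  \<open>\<phi>\<close> serves as \<open>\<xi>\<close>.\<close>

lemma subgrads_scaled_sum_rule:
  fixes \<phi> :: "'a::euclidean_space \<Rightarrow> real"
  assumes conv: "convex_on UNIV \<phi>" and C: "convex C" "x \<in> C" and c: "0 \<le> c"
    and u: "u \<in> subgrads C (\<lambda>y. c * \<phi> y) x"
  obtains \<xi> where "\<xi> \<in> subgrads UNIV \<phi> x" "u - c *\<^sub>R \<xi> \<in> subgrads C (\<lambda>_. 0) x"
proof (cases "c = 0")
  case True
  obtain \<xi> where "\<xi> \<in> subgrads UNIV \<phi> x" using subgrads_nonempty[OF conv] by blast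
  then show ?thesis using that u True by simp
next
  case False
  have "convex_on UNIV (\<lambda>y. c * \<phi> y)" using conv c by (rule convex_on_cmul[rotated])
  from subgrads_sum_rule[OF this C u] obtain \<xi> where
    \<xi>: "\<xi> \<in> subgrads UNIV (\<lambda>y. c * \<phi> y) x" "u - \<xi> \<in> subgrads C (\<lambda>_. 0) x" .
  have "(1 / c) *\<^sub>R \<xi> \<in> subgrads UNIV \<phi> x"
    unfolding subgrads_def
  proof safe
    fix y
    have "c * \<phi> x + inner \<xi> (y - x) \<le> c * \<phi> y" using subgradsD[OF \<xi>(1)] by simp
    then show "\<phi> x + inner ((1 / c) *\<^sub>R \<xi>) (y - x) \<le> \<phi> y"
      using c False by (simp add: field_simps)
  qed
  then show ?thesis using that \<xi>(2) False by simp
qed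

text \<open>The easy converse of the splitting, used to reassemble its parts with another
  coefficient.\<close>

lemma subgrads_add_normal:
  assumes "\<xi> \<in> subgrads UNIV \<phi> x" "\<eta> \<in> subgrads C (\<lambda>_. 0) x" "0 \<le> c"
  shows "c *\<^sub>R \<xi> + \<eta> \<in> subgrads C (\<lambda>y. c * \<phi> y) x"
  unfolding subgrads_def
proof safe
  fix y assume y: "y \<in> C"
  have "c * (\<phi> x + inner \<xi> (y - x)) \<le> c * \<phi> y"
    using subgradsD[OF assms(1)] assms(3) by (intro mult_left_mono) auto
  then show "c * \<phi> x + inner (c *\<^sub>R \<xi> + \<eta>) (y - x) \<le> c * \<phi> y"
    using subgradsD[OF assms(2) y] by (simp add: inner_add_left algebra_simps)
qed

section \<open>Bounds and Lipschitz constants on balls\<close>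

lemma convex_imp_continuous:
  fixes \<phi> :: "'a::euclidean_space \<Rightarrow> real"
  assumes "convex_on UNIV \<phi>"
  shows "continuous_on UNIV \<phi>"
  using convex_on_continuous[OF open_UNIV assms] .

text \<open>Moving one unit along \<open>sgn u\<close> raises the affine minorant by
  \<open>norm u\<close>, while \<open>\<phi>\<close> stays bounded on the ball of radius
  \<open>R + 1\<close>.\<close>

lemma subgrads_bounded:
  fixes \<phi> :: "'a::euclidean_space \<Rightarrow> real"
  assumes conv: "convex_on UNIV \<phi>"
  obtains M where "M > 0" "\<And>x u. norm x \<le> R \<Longrightarrow> u \<in> subgrads UNIV \<phi> x \<Longrightarrow> norm u \<le> M"
proof -
  have "compact (\<phi> ` cball 0 (R + 1))"
    by (intro compact_continuous_image continuous_on_subset[OF convex_imp_continuous[OF conv]]) auto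
  then obtain K where K: "\<And>y. norm y \<le> R + 1 \<Longrightarrow> \<bar>\<phi> y\<bar> \<le> K"
    by (fastforce dest: compact_imp_bounded simp: bounded_iff)
  show thesis
  proof (rule that[of "2 * \<bar>K\<bar> + 1"])
    fix x u assume x: "norm x \<le> R" and u: "u \<in> subgrads UNIV \<phi> x"
    have n1: "norm (sgn u) \<le> 1" by (simp add: norm_sgn)
    have "\<bar>\<phi> x\<bar> \<le> K" using x by (intro K) simp
    moreover have "\<bar>\<phi> (x + sgn u)\<bar> \<le> K"
      using x n1 norm_triangle_ineq[of x "sgn u"] by (intro K) linarith
    moreover have "\<phi> x + inner u (sgn u) \<le> \<phi> (x + sgn u)" using subgradsD[OF u, of "x + sgn u"] by simp
    moreover have "inner u (sgn u) = norm u"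
      by (cases "u = 0") (auto simp: sgn_div_norm dot_square_norm power2_eq_square)
    ultimately show "norm u \<le> 2 * \<bar>K\<bar> + 1" by linarith
  qed simp
qed

lemma convex_lipschitz_bounded:
  fixes \<phi> :: "'a::euclidean_space \<Rightarrow> real"
  assumes conv: "convex_on UNIV \<phi>"
  obtains M where "M > 0" "\<And>x y. norm x \<le> R \<Longrightarrow> norm y \<le> R \<Longrightarrow> \<bar>\<phi> x - \<phi> y\<bar> \<le> M * norm (x - y)"
proof -
  obtain M where M: "M > 0" "\<And>x u. norm x \<le> R \<Longrightarrow> u \<in> subgrads UNIV \<phi> x \<Longrightarrow> norm u \<le> M"
    by (rule subgrads_bounded[OF conv, where R = R]) blast
  have *: "\<phi> x - \<phi> y \<le> M * norm (x - y)" if "norm x \<le> R" for x y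
  proof -
    obtain u where u: "u \<in> subgrads UNIV \<phi> x" using subgrads_nonempty[OF conv] by blast
    have "\<phi> x - \<phi> y \<le> - inner u (y - x)" using subgradsD[OF u, of y] by simp
    also have "\<dots> \<le> norm u * norm (y - x)" using Cauchy_Schwarz_ineq2[of u "y - x"] by linarith
    also have "\<dots> \<le> M * norm (y - x)" using M(2)[OF that u] by (intro mult_right_mono) auto
    finally show ?thesis by (simp add: norm_minus_commute)
  qed
  show thesis
  proof (rule that[OF M(1)])
    fix x y :: 'a assume "norm x \<le> R" "norm y \<le> R"
    then show "\<bar>\<phi> x - \<phi> y\<bar> \<le> M * norm (x - y)"
      using *[of x y] *[of y x] by (simp add: norm_minus_commute)
  qed
qed

lemma locally_lipschitz_bounded:
  fixes D :: "'a::euclidean_space \<Rightarrow> 'b::metric_space"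
  assumes "locally_lipschitz D"
  obtains L where "L > 0" "\<And>x y. norm x \<le> R \<Longrightarrow> norm y \<le> R \<Longrightarrow> dist (D x) (D y) \<le> L * dist x y"
proof -
  \<comment> \<open>This notion concerns maps depending on time; a one-point time set makes its
    compactness theorem apply to \<open>D\<close>.\<close>
  have "local_lipschitz {0::real} (cball 0 R) (\<lambda>_. D)"
  proof (rule local_lipschitzI)
    fix x :: 'a and t :: real
    obtain U L where UL: "open U" "x \<in> U" "\<And>y w. y \<in> U \<Longrightarrow> w \<in> U \<Longrightarrow> dist (D y) (D w) \<le> L * dist y w"
      using assms unfolding locally_lipschitz_def by metis
    obtain u where u: "u > 0" "cball x u \<subseteq> U" using UL open_contains_cball by metis
    have "\<bar>L\<bar>-lipschitz_on (cball x u \<inter> cball 0 R) D"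
    proof (rule lipschitz_onI)
      fix y w assume "y \<in> cball x u \<inter> cball 0 R" "w \<in> cball x u \<inter> cball 0 R"
      then have "dist (D y) (D w) \<le> L * dist y w" using u by (intro UL) auto
      also have "\<dots> \<le> \<bar>L\<bar> * dist y w" by (intro mult_right_mono) auto
      finally show "dist (D y) (D w) \<le> \<bar>L\<bar> * dist y w" .
    qed simp
    then show "\<exists>u>0. \<exists>L. \<forall>t\<in>cball t u \<inter> {0}. L-lipschitz_on (cball x u \<inter> cball 0 R) D"
      using u by blast
  qed
  then obtain L where "\<And>t. t \<in> {0::real} \<Longrightarrow> L-lipschitz_on (cball 0 R) D"
    using local_lipschitz_compact_implies_lipschitz[where X = "cball 0 R" and T = "{0::real}"
        and f = "\<lambda>_. D"] by auto
  then have L: "L-lipschitz_on (cball 0 R) D" by simp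
  show thesis
  proof (rule that[of "\<bar>L\<bar> + 1"])
    fix x y :: 'a assume "norm x \<le> R" "norm y \<le> R"
    then have "dist (D x) (D y) \<le> L * dist x y" using L by (intro lipschitz_onD) auto
    also have "\<dots> \<le> (\<bar>L\<bar> + 1) * dist x y" by (intro mult_right_mono) auto
    finally show "dist (D x) (D y) \<le> (\<bar>L\<bar> + 1) * dist x y" .
  qed simp
qed

text \<open>The mean value theorem on the segment, which stays in the ball, gives \<open>L\<close>
  in place of the sharp \<open>L / 2\<close>; later only the order of the error matters.\<close>

lemma gradient_descent_bound:
  fixes h :: "'a::euclidean_space \<Rightarrow> real"
  assumes grad: "\<And>y. (h has_derivative (\<lambda>v. inner (D y) v)) (at y)"
    and lip: "\<And>x y. norm x \<le> R \<Longrightarrow> norm y \<le> R \<Longrightarrow> dist (D x) (D y) \<le> L * dist x y"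
    and "0 \<le> L" and xy: "norm x \<le> R" "norm y \<le> R"
  shows "\<bar>h y - h x - inner (D x) (y - x)\<bar> \<le> L * (norm (y - x))\<^sup>2"
proof -
  let ?p = "\<lambda>t. x + t *\<^sub>R (y - x)"
  have "((\<lambda>t. h (?p t)) has_derivative (\<lambda>s. inner (D (?p t)) (s *\<^sub>R (y - x)))) (at t within {0..1})" for t
    by (rule has_derivative_compose[OF _ grad]) (auto intro!: derivative_eq_intros)
  then have "\<exists>t\<in>{0..1}. h (?p 1) - h (?p 0) = inner (D (?p t)) ((1 - 0) *\<^sub>R (y - x))"
    by (intro mvt_very_simple[where f = "\<lambda>t. h (?p t)"]) auto
  then obtain t where t: "0 \<le> t" "t \<le> 1" and "h y - h x = inner (D (?p t)) (y - x)"
    by auto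
  then have "h y - h x - inner (D x) (y - x) = inner (D (?p t) - D x) (y - x)"
    by (simp add: inner_diff_left)
  also have "\<bar>\<dots>\<bar> \<le> norm (D (?p t) - D x) * norm (y - x)" by (rule Cauchy_Schwarz_ineq2)
  also have "\<dots> \<le> (L * norm (y - x)) * norm (y - x)"
  proof (rule mult_right_mono)
    have "?p t = (1 - t) *\<^sub>R x + t *\<^sub>R y" by (simp add: algebra_simps)
    also have "norm \<dots> \<le> R"
      using convexD[of "cball 0 R" x y "1 - t" t] xy t by auto
    finally have "dist (D (?p t)) (D x) \<le> L * dist (?p t) x" using xy by (intro lip)
    also have "\<dots> = L * (t * norm (y - x))" using t by (simp add: dist_norm)
    also have "\<dots> \<le> L * norm (y - x)"
      using t \<open>0 \<le> L\<close> by (intro mult_left_mono mult_left_le_one_le) auto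
    finally show "norm (D (?p t) - D x) \<le> L * norm (y - x)" by (simp add: dist_norm)
  qed simp
  finally show ?thesis by (simp add: power2_eq_square mult_ac)
qed

section \<open>Conjugates and proximal points\<close>

lemma conjugate_ge: "ereal (inner x z - h x) \<le> conjugate h z"
  unfolding conjugate_def by (rule SUP_upper) simp

text \<open>Equality case of Fenchel-Young; it makes the conjugate finite and explicit at every
  \<open>z\<close> that the algorithm selects.\<close>

lemma conjugate_subgrad:
  assumes "z \<in> subgrads UNIV h x"
  shows "conjugate h z = ereal (inner x z - h x)"
proof (rule antisym[OF _ conjugate_ge])
  show "conjugate h z \<le> ereal (inner x z - h x)"
    unfolding conjugate_def
  proof (rule SUP_least)
    fix y show "ereal (inner y z - h y) \<le> ereal (inner x z - h x)"
      using subgradsD[OF assms, of y] by (simp add: inner_diff_right inner_commute)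
  qed
qed

text \<open>Minimality is tested along the segment from \<open>x\<close> to \<open>w\<close>; to
  first order the quadratic contributes \<open>inner (x - y) (w - x)\<close>.\<close>

lemma prox_subgrad:
  assumes conv: "convex_on C \<phi>" and x: "x \<in> prox (indicator_plus C \<phi>) y"
  shows "x \<in> C" "y - x \<in> subgrads C \<phi> x"
proof -
  show xC: "x \<in> C" using x by (auto simp: prox_def indicator_plus_def split: if_splits)
  have min: "\<phi> x + (norm (x - y))\<^sup>2 / 2 \<le> \<phi> w + (norm (w - y))\<^sup>2 / 2" if "w \<in> C" for w
    using x that xC unfolding prox_def indicator_plus_def by (auto dest: spec[of _ w])
  show "y - x \<in> subgrads C \<phi> x"
    unfolding subgrads_def
  proof safe
    fix w assume w: "w \<in> C"
    have "0 \<le> (\<phi> w - \<phi> x) + inner (x - y) (w - x)"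
    proof (rule nonneg_if_nonneg_along_segment)
      fix t :: real assume t: "0 < t" "t \<le> 1"
      have "(1 - t) *\<^sub>R x + t *\<^sub>R w \<in> C"
        using t xC w convex_on_imp_convex[OF conv] by (intro convexD) auto
      then have "x + t *\<^sub>R (w - x) \<in> C" by (simp add: algebra_simps)
      from min[OF this] have "\<phi> x + (norm (x - y))\<^sup>2 / 2
          \<le> \<phi> (x + t *\<^sub>R (w - x)) + (norm ((x - y) + t *\<^sub>R (w - x)))\<^sup>2 / 2" by (simp add: algebra_simps)
      moreover have "(norm ((x - y) + t *\<^sub>R (w - x)))\<^sup>2
          = (norm (x - y))\<^sup>2 + 2 * (t * inner (x - y) (w - x)) + t\<^sup>2 * (norm (w - x))\<^sup>2"
        unfolding power2_norm_eq_inner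
        by (simp add: inner_add_left inner_add_right inner_commute power2_eq_square)
      moreover have "\<phi> (x + t *\<^sub>R (w - x)) - \<phi> x \<le> t * (\<phi> w - \<phi> x)"
        using t by (intro convex_on_line_diff[OF conv xC w]) auto
      ultimately show "0 \<le> t * ((\<phi> w - \<phi> x) + inner (x - y) (w - x)) + t\<^sup>2 * ((norm (w - x))\<^sup>2 / 2)"
        by (simp add: algebra_simps)
    qed
    then show "\<phi> x + inner (y - x) (w - x) \<le> \<phi> w" by (simp add: inner_diff_left)
  qed
qed

section \<open>Desingularizing functions and summability of steps\<close>

section \<open>Finite length from the Kurdyka-Lojasiewicz inequality\<close>

text \<open>Concavity enters as the tangent inequality at positive arguments. In this form the class
  is closed under addition, which merges local KL inequalities.\<close>

definition desingularizing :: "real \<Rightarrow> (real \<Rightarrow> real) \<Rightarrow> (real \<Rightarrow> real) \<Rightarrow> bool" where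
  "desingularizing a \<psi> \<psi>' \<longleftrightarrow> 0 < a \<and>
     (\<forall>s. 0 < s \<and> s < a \<longrightarrow> 0 \<le> \<psi> s \<and> 0 \<le> \<psi>' s) \<and>
     (\<forall>s t. 0 < t \<and> t \<le> s \<and> s < a \<longrightarrow> \<psi>' s * (s - t) \<le> \<psi> s - \<psi> t)"

lemma desingularizing_add:
  assumes "desingularizing a \<psi> \<psi>'" "desingularizing b \<theta> \<theta>'"
  shows "desingularizing (min a b) (\<lambda>s. \<psi> s + \<theta> s) (\<lambda>s. \<psi>' s + \<theta>' s)"
proof -
  have "(\<psi>' s + \<theta>' s) * (s - t) \<le> (\<psi> s + \<theta> s) - (\<psi> t + \<theta> t)" if "0 < t" "t \<le> s" "s < min a b" for s t
  proof -
    have "\<psi>' s * (s - t) \<le> \<psi> s - \<psi> t" "\<theta>' s * (s - t) \<le> \<theta> s - \<theta> t"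
      using assms that unfolding desingularizing_def by auto
    then show ?thesis by (simp add: algebra_simps)
  qed
  then show ?thesis using assms unfolding desingularizing_def by auto
qed

lemma KL_at_desingularizing:
  assumes "KL_at \<phi> p"
  obtains a U \<psi> \<psi>' where "desingularizing a \<psi> \<psi>'" "open U" "p \<in> U"
    "\<And>x. \<lbrakk>x \<in> U; \<phi> p < \<phi> x; \<phi> x < \<phi> p + ereal a; lsubdiff \<phi> x \<noteq> {}\<rbrakk>
       \<Longrightarrow> 1 \<le> \<psi>' (real_of_ereal (\<phi> x - \<phi> p)) * infdist 0 (lsubdiff \<phi> x)"
proof -
  obtain a U \<psi> \<psi>' where a: "(a::ereal) > 0" and U: "open U" "p \<in> U"
    and conc: "concave_on {s. 0 \<le> s \<and> ereal s < a} \<psi>"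
    and pos: "\<And>s. 0 \<le> s \<Longrightarrow> ereal s < a \<Longrightarrow> 0 \<le> \<psi> s"
    and der: "\<And>s. 0 < s \<Longrightarrow> ereal s < a \<Longrightarrow> (\<psi> has_real_derivative \<psi>' s) (at s)"
    and dpos: "\<And>s. 0 < s \<Longrightarrow> ereal s < a \<Longrightarrow> \<psi>' s > 0"
    and KL: "\<And>x. \<lbrakk>x \<in> U; \<phi> p < \<phi> x; \<phi> x < \<phi> p + a; lsubdiff \<phi> x \<noteq> {}\<rbrakk>
       \<Longrightarrow> 1 \<le> \<psi>' (real_of_ereal (\<phi> x - \<phi> p)) * infdist 0 (lsubdiff \<phi> x)"
    using assms unfolding KL_at_def by blast
  \<comment> \<open>The radius \<open>a\<close> may be infinite; a finite positive one below it is
    kept.\<close>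
  obtain b where b: "0 < b" "ereal b \<le> a"
    using a ereal_dense2[of 0 a] by (metis ereal_less(2) less_imp_le)
  have lt: "ereal s < a" if "s < b" for s using that b(2) by (meson ereal_less_eq(3) less_ereal.simps(1) order_less_le_trans)
  show thesis
  proof (rule that[of b \<psi> \<psi>' U])
    have "\<psi>' s * (s - t) \<le> \<psi> s - \<psi> t" if t: "0 < t" "t \<le> s" "s < b" for s t
    proof -
      have "convex_on {0<..<b} (\<lambda>s. - \<psi> s)"
        using conc lt unfolding concave_on_def by (rule_tac convex_on_subset) (auto simp: less_imp_le)
      then have "- \<psi> t - - \<psi> s \<ge> (- \<psi>' s) * (t - s)"
      proof (rule convex_on_imp_above_tangent)
        show "connected {0<..<b}" by simp
        show "s \<in> interior {0<..<b}" "t \<in> {0<..<b}" using t by auto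
        show "((\<lambda>s. - \<psi> s) has_real_derivative - \<psi>' s) (at s within {0<..<b})"
          using t by (intro DERIV_subset[OF DERIV_minus[OF der]] lt) auto
      qed
      then show ?thesis by (simp add: algebra_simps)
    qed
    then show "desingularizing b \<psi> \<psi>'"
      unfolding desingularizing_def using b pos dpos lt by (auto simp: less_imp_le)
    fix x assume x: "x \<in> U" "\<phi> p < \<phi> x" "\<phi> x < \<phi> p + ereal b" "lsubdiff \<phi> x \<noteq> {}"
    have "\<phi> p + ereal b \<le> \<phi> p + a" by (intro add_left_mono b)
    then show "1 \<le> \<psi>' (real_of_ereal (\<phi> x - \<phi> p)) * infdist 0 (lsubdiff \<phi> x)"
      using x by (intro KL) auto
  qed (use U in auto)
qed

text \<open>Here \<open>h\<close> is to be the excess of values over a common limit and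
  \<open>d\<close> the distance of 0 to the subdifferential. With no base point in it, the
  inequality can be joined over several neighbourhoods.\<close>

definition KL_along :: "'a set \<Rightarrow> (nat \<Rightarrow> 'a) \<Rightarrow> (nat \<Rightarrow> real) \<Rightarrow> (nat \<Rightarrow> real) \<Rightarrow> bool" where
  "KL_along U w h d \<longleftrightarrow> (\<exists>a \<psi> \<psi>'. desingularizing a \<psi> \<psi>' \<and>
     (\<forall>\<^sub>F k in sequentially. w k \<in> U \<and> 0 < h k \<and> h k < a \<longrightarrow> 1 \<le> \<psi>' (h k) * d k))"

text \<open>All terms are nonnegative, so adding the other derivative cannot spoil whichever
  inequality is in force.\<close>

lemma KL_along_Un:
  assumes "KL_along U w h d" "KL_along V w h d" and d: "\<And>k. 0 \<le> d k"
  shows "KL_along (U \<union> V) w h d"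
proof -
  obtain a \<psi> \<psi>' where 1: "desingularizing a \<psi> \<psi>'"
    "\<forall>\<^sub>F k in sequentially. w k \<in> U \<and> 0 < h k \<and> h k < a \<longrightarrow> 1 \<le> \<psi>' (h k) * d k"
    using assms(1) unfolding KL_along_def by blast
  obtain b \<theta> \<theta>' where 2: "desingularizing b \<theta> \<theta>'"
    "\<forall>\<^sub>F k in sequentially. w k \<in> V \<and> 0 < h k \<and> h k < b \<longrightarrow> 1 \<le> \<theta>' (h k) * d k"
    using assms(2) unfolding KL_along_def by blast
  have "\<forall>\<^sub>F k in sequentially. w k \<in> U \<union> V \<and> 0 < h k \<and> h k < min a b
      \<longrightarrow> 1 \<le> (\<psi>' (h k) + \<theta>' (h k)) * d k"
    using 1(2) 2(2)
  proof eventually_elim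
    case (elim k)
    show ?case
    proof
      assume k: "w k \<in> U \<union> V \<and> 0 < h k \<and> h k < min a b"
      then have "0 \<le> \<psi>' (h k)" "0 \<le> \<theta>' (h k)" using 1(1) 2(1) unfolding desingularizing_def by auto
      then have "0 \<le> \<psi>' (h k) * d k" "0 \<le> \<theta>' (h k) * d k" using d by auto
      then show "1 \<le> (\<psi>' (h k) + \<theta>' (h k)) * d k" using elim k by (auto simp: distrib_right)
    qed
  qed
  then show ?thesis
    unfolding KL_along_def using desingularizing_add[OF 1(1) 2(1)] by blast
qed

lemma KL_along_avoided:
  assumes "\<forall>\<^sub>F k in sequentially. w k \<notin> U"
  shows "KL_along U w h d"
proof -
  have "desingularizing 1 (\<lambda>_. 0) (\<lambda>_. 0)" by (simp add: desingularizing_def)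
  moreover have "\<forall>\<^sub>F k in sequentially. w k \<in> U \<and> 0 < h k \<and> h k < 1 \<longrightarrow> 1 \<le> (0::real) * d k"
    using assms by eventually_elim simp
  ultimately show ?thesis unfolding KL_along_def
    by (intro exI[of _ "1::real"] exI[of _ "\<lambda>_. 0"] conjI)
qed

text \<open>The desingularizing functions of a finite subcover are summed. The result is uniform
  over \<open>K\<close>, so \<open>w\<close> need not converge.\<close>

lemma KL_along_compact:
  assumes K: "compact K" and d: "\<And>k. 0 \<le> d k"
    and loc: "\<And>p. p \<in> K \<Longrightarrow> \<exists>U. open U \<and> p \<in> U \<and> KL_along U w h d"
  shows "KL_along K w h d"
proof -
  have "\<forall>p\<in>K. \<exists>U. open U \<and> p \<in> U \<and> KL_along U w h d" using loc by blast
  then obtain U where U: "\<And>p. p \<in> K \<Longrightarrow> open (U p) \<and> p \<in> U p \<and> KL_along (U p) w h d"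
    by metis
  obtain D where D: "D \<subseteq> K" "finite D" "K \<subseteq> (\<Union>p\<in>D. U p)"
    by (rule compactE_image[OF K, of K U]) (use U in auto)
  have "KL_along (\<Union>p\<in>D. U p) w h d"
    using D(2,1)
  proof (induction D rule: finite_induct)
    case empty show ?case by (rule KL_along_avoided) simp
  next
    case (insert p D)
    then show ?case using U d by (simp add: KL_along_Un)
  qed
  then obtain a \<psi> \<psi>' where *: "desingularizing a \<psi> \<psi>'"
    "\<forall>\<^sub>F k in sequentially. w k \<in> (\<Union>p\<in>D. U p) \<and> 0 < h k \<and> h k < a \<longrightarrow> 1 \<le> \<psi>' (h k) * d k"
    unfolding KL_along_def by blast
  have "\<forall>\<^sub>F k in sequentially. w k \<in> K \<and> 0 < h k \<and> h k < a \<longrightarrow> 1 \<le> \<psi>' (h k) * d k"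
    using *(2) by eventually_elim (use D(3) in blast)
  then show ?thesis using *(1) unfolding KL_along_def by blast
qed

text \<open>The tangent inequality turns the decrease \<open>s * (\<Delta> (Suc k))\<^sup>2\<close>
  into a drop of \<open>\<psi>\<close> along \<open>h\<close>, and KL keeps
  \<open>\<psi>' (h (Suc k)) * \<Delta> k\<close> away from 0. So the squared step is at most a
  multiple of \<open>\<Delta> k\<close> times the drop, which the mean inequality turns into a
  telescoping bound.\<close>

lemma KL_finite_length:
  fixes h \<Delta> d :: "nat \<Rightarrow> real"
  assumes dec: "\<And>k. h (Suc k) + s * (\<Delta> k)\<^sup>2 \<le> h k" and s: "0 < s"
    and h0: "\<And>k. 0 \<le> h k" and hlim: "h \<longlonglongrightarrow> 0" and \<Delta>0: "\<And>k. 0 \<le> \<Delta> k"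
    and d: "\<And>k. d (Suc k) \<le> b * \<Delta> k"
    and KL: "KL_along K w h d" and wK: "\<And>k. w k \<in> K"
  shows "summable \<Delta>"
proof (cases "\<exists>k. h k = 0")
  \<comment> \<open>KL is silent where \<open>h\<close> is 0; but then \<open>h\<close> stays 0 and
    all later steps vanish.\<close>
  case True
  then obtain k where k: "h k = 0" by blast
  have "decseq h"
  proof (rule decseq_SucI)
    fix n
    have "0 \<le> s * (\<Delta> n)\<^sup>2" using s by simp
    then show "h (Suc n) \<le> h n" using dec[of n] by linarith
  qed
  then have hz: "h j = 0" if "j \<ge> k" for j
    using decseqD[of h k j] h0[of j] k that by simp
  show ?thesis
  proof (rule summable_finite[of "{..<k}"])
    fix j assume "j \<notin> {..<k}"
    then have "h j = 0" "h (Suc j) = 0" using hz by auto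
    then have "s * (\<Delta> j)\<^sup>2 \<le> 0" using dec[of j] by simp
    then show "\<Delta> j = 0" using s by (simp add: mult_le_0_iff)
  qed simp
next
  case False
  then have hpos: "0 < h k" for k using h0[of k] by (metis less_le)
  obtain a \<psi> \<psi>' where des: "desingularizing a \<psi> \<psi>'"
    and ev: "\<forall>\<^sub>F k in sequentially. w k \<in> K \<and> 0 < h k \<and> h k < a \<longrightarrow> 1 \<le> \<psi>' (h k) * d k"
    using KL unfolding KL_along_def by blast
  have "\<forall>\<^sub>F k in sequentially. h k < a"
    using order_tendstoD(2)[OF hlim] des unfolding desingularizing_def by blast
  with ev have "\<forall>\<^sub>F k in sequentially. h k < a \<and> 1 \<le> \<psi>' (h k) * d k"
    by eventually_elim (simp add: wK hpos)
  then obtain N where N: "\<And>k. k \<ge> N \<Longrightarrow> h k < a" "\<And>k. k \<ge> N \<Longrightarrow> 1 \<le> \<psi>' (h k) * d k"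
    unfolding eventually_sequentially by blast
  define M where "M = \<bar>b\<bar> / s"
  have M: "0 \<le> M" using s by (simp add: M_def)
  have step: "2 * \<Delta> (Suc k) \<le> \<Delta> k + M * (\<psi> (h (Suc k)) - \<psi> (h (Suc (Suc k))))" if k: "k \<ge> N" for k
  proof -
    let ?D = "\<Delta> k" and ?E = "\<Delta> (Suc k)" and ?P = "\<psi> (h (Suc k)) - \<psi> (h (Suc (Suc k)))"
    let ?q = "\<psi>' (h (Suc k))"
    have le: "s * ?E\<^sup>2 \<le> h (Suc k) - h (Suc (Suc k))" using dec[of "Suc k"] by linarith
    moreover have "0 \<le> s * ?E\<^sup>2" using s by simp
    ultimately have le': "h (Suc (Suc k)) \<le> h (Suc k)" by linarith
    have ha: "h (Suc k) < a" using N(1)[of "Suc k"] k by simp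
    have q0: "0 \<le> ?q" using des hpos ha unfolding desingularizing_def by blast
    have "?q * (s * ?E\<^sup>2) \<le> ?q * (h (Suc k) - h (Suc (Suc k)))" using le q0 by (rule mult_left_mono)
    also have "\<dots> \<le> ?P" using des hpos le' ha unfolding desingularizing_def by blast
    finally have qP: "?q * (s * ?E\<^sup>2) \<le> ?P" .
    then have P0: "0 \<le> ?P" using q0 s by (smt (verit) mult_nonneg_nonneg zero_le_power2)
    have "1 \<le> ?q * d (Suc k)" using N(2)[of "Suc k"] k by simp
    also have "\<dots> \<le> ?q * (\<bar>b\<bar> * ?D)"
    proof (rule mult_left_mono[OF _ q0])
      have "d (Suc k) \<le> b * ?D" by (rule d)
      also have "\<dots> \<le> \<bar>b\<bar> * ?D" by (intro mult_right_mono \<Delta>0) simp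
      finally show "d (Suc k) \<le> \<bar>b\<bar> * ?D" .
    qed
    finally have "1 * (s * ?E\<^sup>2) \<le> (?q * (\<bar>b\<bar> * ?D)) * (s * ?E\<^sup>2)"
      using s by (intro mult_right_mono) auto
    also have "\<dots> = (?q * (s * ?E\<^sup>2)) * (\<bar>b\<bar> * ?D)" by simp
    also have "\<dots> \<le> ?P * (\<bar>b\<bar> * ?D)" using qP \<Delta>0 by (intro mult_right_mono) auto
    finally have "?E\<^sup>2 \<le> (M * ?P) * ?D" using s by (simp add: M_def field_simps)
    \<comment> \<open>Arithmetic-geometric mean inequality.\<close>
    moreover have "4 * ((M * ?P) * ?D) \<le> (?D + M * ?P)\<^sup>2"
      using zero_le_power2[of "?D - M * ?P"] by (simp add: power2_eq_square algebra_simps)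
    ultimately have "(2 * ?E)\<^sup>2 \<le> (?D + M * ?P)\<^sup>2" by (simp add: power_mult_distrib)
    then show ?thesis using \<Delta>0 M P0 by (auto intro: power2_le_imp_le[rotated])
  qed
  define e where "e n = \<Delta> (n + N)" for n
  define q where "q n = M * \<psi> (h (Suc (n + N)))" for n
  have q0: "0 \<le> q n" for n
    using des hpos N(1)[of "Suc (n + N)"] M unfolding q_def desingularizing_def by auto
  have e0: "0 \<le> e n" for n by (simp add: e_def \<Delta>0)
  have estep: "2 * e (Suc n) \<le> e n + (q n - q (Suc n))" for n
    using step[of "n + N"] by (simp add: e_def q_def right_diff_distrib)
  \<comment> \<open>Of the two copies of \<open>e (Suc n)\<close> in \<open>estep\<close>, one joins
    the sum and the other replaces \<open>e n\<close>.\<close>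
  have "(\<Sum>i<n. e (Suc i)) + e n + q n \<le> e 0 + q 0" for n
  proof (induction n)
    case (Suc n) then show ?case using estep[of n] by simp
  qed simp
  then have "(\<Sum>i<n. e (Suc i)) \<le> e 0 + q 0" for n
    using e0[of n] q0[of n] by (smt (verit))
  then have "summable (\<lambda>n. e (Suc n))" using e0 by (intro summableI_nonneg_bounded)
  then have "summable e" by (simp only: summable_Suc_iff)
  then show ?thesis unfolding e_def by (simp only: summable_iff_shift)
qed

lemma convergent_if_summable_steps:
  fixes x :: "nat \<Rightarrow> 'a::banach"
  assumes "summable (\<lambda>k. norm (x (Suc k) - x k))"
  shows "convergent x"
proof -
  have "summable (\<lambda>k. x (Suc k) - x k)" using assms by (rule summable_norm_cancel)
  then have "convergent (\<lambda>n. \<Sum>k<n. x (Suc k) - x k)" by (simp add: summable_iff_convergent)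
  then have "convergent (\<lambda>n. x n - x 0)" by (simp add: sum_lessThan_telescope)
  then show ?thesis by (simp add: convergent_diff_const_right_iff)
qed

section \<open>Subgradients of \<open>H\<close> and of the prox step\<close>

section \<open>Fractional programs\<close>

text \<open>At \<open>c = f x / g x\<close> the last component vanishes. The product \<open>c * f x\<close>
  is not jointly convex; its defect \<open>2 * (c' - c) * (f y - f x)\<close> is of smaller than first order.\<close>
lemma Hfun_fsubdiff:
  fixes f g h1 h2 :: "'a::euclidean_space \<Rightarrow> real"
  assumes g: "(g has_derivative (\<lambda>v. inner (Dg x) v)) (at x)"
    and h1: "(h1 has_derivative (\<lambda>v. inner (Dh1 x) v)) (at x)"
    and f: "isCont f x" and x: "x \<in> C"
    and u: "u \<in> subgrads C (\<lambda>y. 2 * c * f y) x" and z: "z \<in> subgrads UNIV h2 p"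
  shows "(u - c\<^sup>2 *\<^sub>R Dg x + Dh1 x - z, p - x, 2 * f x - 2 * c * g x)
    \<in> fsubdiff (Hfun f g h1 h2 C) (x, z, c)"
proof -
  let ?v = "(u - c\<^sup>2 *\<^sub>R Dg x + Dh1 x - z, p - x, 2 * f x - 2 * c * g x)"
  let ?w = "(x, z, c)"
  \<comment> \<open>The differentiable part of \<open>H\<close> after replacing
    \<open>conjugate h2\<close> by its affine minorant \<open>inner p z' - h2 p\<close>, exact at
    \<open>z\<close>; the constant \<open>- h2 p\<close> is kept outside.\<close>
  define G where "G w = h1 (fst w) - (snd (snd w))\<^sup>2 * g (fst w) - inner (fst w) (fst (snd w))
    + inner p (fst (snd w))" for w :: "'a \<times> 'a \<times> real"
  define G' where "G' v = inner (Dh1 x) (fst v)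
    - (c\<^sup>2 * inner (Dg x) (fst v) + 2 * c * snd (snd v) * g x)
    - (inner x (fst (snd v)) + inner (fst v) z) + inner p (fst (snd v))" for v :: "'a \<times> 'a \<times> real"
  have fst': "(fst has_derivative fst) (at ?w)"
    by (rule bounded_linear.has_derivative[OF bounded_linear_fst has_derivative_ident])
  have sf': "((\<lambda>w. fst (snd w)) has_derivative (\<lambda>w. fst (snd w))) (at ?w)"
    by (intro has_derivative_fst has_derivative_snd has_derivative_ident)
  have ss': "((\<lambda>w. snd (snd w)) has_derivative (\<lambda>w. snd (snd w))) (at ?w)"
    by (intro has_derivative_snd has_derivative_ident)
  have h1': "((\<lambda>w. h1 (fst w)) has_derivative (\<lambda>v. inner (Dh1 x) (fst v))) (at ?w)"
    using has_derivative_compose[OF fst', of h1 "\<lambda>v. inner (Dh1 x) v"] h1 by simp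
  have g': "((\<lambda>w. g (fst w)) has_derivative (\<lambda>v. inner (Dg x) (fst v))) (at ?w)"
    using has_derivative_compose[OF fst', of g "\<lambda>v. inner (Dg x) v"] g by simp
  have "(G has_derivative G') (at ?w)"
    unfolding G_def [abs_def] G'_def [abs_def]
    by (rule derivative_eq_intros h1' g' fst' sf' ss' refl)+ (simp add: algebra_simps)
  then have Gd: "\<exists>\<delta>>0. \<forall>w. norm (w - ?w) < \<delta> \<longrightarrow> \<bar>G w - G ?w - G' (w - ?w)\<bar> \<le> e * norm (w - ?w)"
    if "e > 0" for e
    using that unfolding has_derivative_at_alt real_norm_def by blast
  have Hw: "Hfun f g h1 h2 C ?w = ereal (2 * c * f x + G ?w - h2 p)"
    using x by (simp add: Hfun_def indicator_plus_def conjugate_subgrad[OF z] G_def)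
  have "\<exists>\<delta>>0. \<forall>w. norm (w - ?w) < \<delta> \<longrightarrow>
      Hfun f g h1 h2 C ?w + ereal (inner ?v (w - ?w) - e * norm (w - ?w)) \<le> Hfun f g h1 h2 C w"
    if e: "e > 0" for e
  proof -
    obtain \<delta>1 where \<delta>1: "\<delta>1 > 0"
      "\<And>w. norm (w - ?w) < \<delta>1 \<Longrightarrow> \<bar>G w - G ?w - G' (w - ?w)\<bar> \<le> e / 2 * norm (w - ?w)"
      using Gd[of "e / 2"] e by auto
    \<comment> \<open>With \<open>e / 4\<close> the product defect costs \<open>e / 2\<close> per
      unit of \<open>norm (w - ?w)\<close>; the other half pays for linearising
      \<open>G\<close>.\<close>
    obtain \<delta>2 where \<delta>2: "\<delta>2 > 0" "\<And>y. norm (y - x) < \<delta>2 \<Longrightarrow> \<bar>f y - f x\<bar> < e / 4"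
      using f e unfolding continuous_at_eps_delta dist_norm real_norm_def
      by (metis divide_pos_pos zero_less_numeral)
    have "Hfun f g h1 h2 C ?w + ereal (inner ?v (w - ?w) - e * norm (w - ?w)) \<le> Hfun f g h1 h2 C w"
      if w: "norm (w - ?w) < min \<delta>1 \<delta>2" for w
    proof -
      obtain y z' c' where weq: "w = (y, z', c')" using prod_cases3 by blast
      have conj: "ereal (inner p z' - h2 p) \<le> conjugate h2 z'" by (rule conjugate_ge)
      show ?thesis
      proof (cases "y \<in> C")
        case False
        then show ?thesis using conj by (auto simp: Hfun_def indicator_plus_def weq)
      next
        case True
        have ny: "norm (y - x) \<le> norm (w - ?w)"
          using norm_fst_le[of "y - x" "(z' - z, c' - c)"] by (simp add: weq)
        have nc: "\<bar>c' - c\<bar> \<le> norm (w - ?w)"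
          using norm_snd_le[of "c' - c" "z' - z"] norm_snd_le[of "(z' - z, c' - c)" "y - x"] by (simp add: weq)
        have "\<bar>(c' - c) * (f y - f x)\<bar> \<le> norm (w - ?w) * (e / 4)"
          unfolding abs_mult using nc \<delta>2(2)[of y] ny w by (intro mult_mono) auto
        then have 1: "2 * (c' - c) * (f y - f x) \<ge> - (e / 2 * norm (w - ?w))"
          unfolding mult.assoc[of 2] by (simp add: abs_le_iff mult.commute)
        have 2: "G w - G ?w - G' (w - ?w) \<ge> - (e / 2 * norm (w - ?w))"
          using \<delta>1(2)[of w] w unfolding abs_le_iff by linarith
        have 3: "2 * c * f x + inner u (y - x) \<le> 2 * c * f y" by (rule subgradsD[OF u True])
        have 4: "inner ?v (w - ?w) = inner u (y - x) + G' (w - ?w) + 2 * (c' - c) * f x"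
          by (simp add: weq G'_def inner_diff_left inner_diff_right inner_add_left inner_commute algebra_simps)
        have "2 * c * f x + G ?w - h2 p + (inner ?v (w - ?w) - e * norm (w - ?w)) \<le> 2 * c' * f y + G w - h2 p"
          using 1 2 3 unfolding 4 by (simp add: algebra_simps)
        then have "Hfun f g h1 h2 C ?w + ereal (inner ?v (w - ?w) - e * norm (w - ?w))
            \<le> ereal (2 * c' * f y - c'\<^sup>2 * g y + h1 y - inner y z') + ereal (inner p z' - h2 p)"
          unfolding Hw by (simp add: weq G_def)
        also have "\<dots> \<le> ereal (2 * c' * f y - c'\<^sup>2 * g y + h1 y - inner y z') + conjugate h2 z'"
          by (rule add_left_mono[OF conj])
        also have "\<dots> = Hfun f g h1 h2 C w" using True by (simp add: weq Hfun_def indicator_plus_def)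
        finally show ?thesis .
      qed
    qed
    then show ?thesis using \<delta>1(1) \<delta>2(1) by (intro exI[of _ "min \<delta>1 \<delta>2"]) auto
  qed
  then show ?thesis unfolding fsubdiff_def by (simp add: Hw)
qed

text \<open>Dividing the optimality condition by \<open>\<alpha>\<close> leaves a function free of
  the step size, so that iterations become comparable.\<close>

lemma prox_step_subgrad:
  fixes f :: "'a::euclidean_space \<Rightarrow> real"
  assumes conv: "convex_on UNIV f" and C: "convex C" and c: "0 \<le> c" and \<alpha>: "0 < \<alpha>"
    and y: "y \<in> prox (indicator_plus C (\<lambda>w. 2 * \<alpha> * c * f w)) (x - \<alpha> *\<^sub>R v)"
  shows "y \<in> C" "(1 / \<alpha>) *\<^sub>R (x - y) - v \<in> subgrads C (\<lambda>w. 2 * c * f w) y"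
proof -
  have "convex_on C (\<lambda>w. (2 * \<alpha> * c) * f w)"
    using c \<alpha> convex_on_subset[OF conv subset_UNIV C] by (intro convex_on_cmul) auto
  note * = prox_subgrad[OF this y]
  show "y \<in> C" by (rule *(1))
  show "(1 / \<alpha>) *\<^sub>R (x - y) - v \<in> subgrads C (\<lambda>w. 2 * c * f w) y"
    unfolding subgrads_def
  proof safe
    fix w assume "w \<in> C"
    have "\<alpha> *\<^sub>R ((1 / \<alpha>) *\<^sub>R (x - y) - v) = x - \<alpha> *\<^sub>R v - y"
      using \<alpha> by (simp add: algebra_simps)
    then have "\<alpha> * inner ((1 / \<alpha>) *\<^sub>R (x - y) - v) (w - y) = inner (x - \<alpha> *\<^sub>R v - y) (w - y)"
      by (metis inner_scaleR_left)
    with subgradsD[OF *(2) \<open>w \<in> C\<close>]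
    have "\<alpha> * (2 * c * f y + inner ((1 / \<alpha>) *\<^sub>R (x - y) - v) (w - y)) \<le> \<alpha> * (2 * c * f w)"
      by (simp add: distrib_left mult_ac)
    then show "2 * c * f y + inner ((1 / \<alpha>) *\<^sub>R (x - y) - v) (w - y) \<le> 2 * c * f w"
      using \<alpha> by simp
  qed
qed

section \<open>The fractional program and its bounds on compact sets\<close>

lemma continuous_on_compact_bound:
  fixes \<phi> :: "'a::topological_space \<Rightarrow> 'b::real_normed_vector"
  assumes "compact X" "continuous_on X \<phi>"
  obtains K where "0 \<le> K" "\<And>x. x \<in> X \<Longrightarrow> norm (\<phi> x) \<le> K"
proof -
  have "bounded (\<phi> ` X)" by (intro compact_imp_bounded compact_continuous_image assms)
  then obtain K where "\<And>x. x \<in> X \<Longrightarrow> norm (\<phi> x) \<le> K" by (auto simp: bounded_iff)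
  then show thesis by (intro that[of "\<bar>K\<bar>"]) (force intro: order_trans)+
qed

lemma locally_lipschitz_continuous:
  fixes D :: "'a::euclidean_space \<Rightarrow> 'b::metric_space"
  assumes "locally_lipschitz D"
  shows "continuous_on UNIV D"
  unfolding continuous_on_eq_continuous_at[OF open_UNIV]
proof
  fix x :: 'a
  obtain L where L: "L > 0"
    "\<And>y w. norm y \<le> norm x + 1 \<Longrightarrow> norm w \<le> norm x + 1 \<Longrightarrow> dist (D y) (D w) \<le> L * dist y w"
    by (rule locally_lipschitz_bounded[OF assms, where R = "norm x + 1"]) blast
  have "L-lipschitz_on (ball x 1) D"
  proof (rule lipschitz_onI)
    have *: "norm y \<le> norm x + 1" if "y \<in> ball x 1" for y
      using that norm_triangle_ineq2[of y x] by (simp add: dist_norm norm_minus_commute)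
    fix y w assume "y \<in> ball x 1" "w \<in> ball x 1"
    then show "dist (D y) (D w) \<le> L * dist y w" by (intro L(2) *)
  qed (use L in simp)
  then have "continuous_on (ball x 1) D" by (rule lipschitz_on_continuous_on)
  then show "isCont D x" by (auto simp: continuous_on_eq_continuous_at)
qed

locale fractional_program =
  fixes f g h1 h2 :: "'a::euclidean_space \<Rightarrow> real" and Dg Dh1 :: "'a \<Rightarrow> 'a" and C :: "'a set"
  assumes f_nonneg: "0 \<le> f y" and g_nonneg: "0 \<le> g y"
    and C_convex: "convex C"
    and f_convex: "convex_on UNIV f"
    and g_grad: "(g has_derivative (\<lambda>v. inner (Dg y) v)) (at y)"
    and Dg_lip: "locally_lipschitz Dg"
    and h1_grad: "(h1 has_derivative (\<lambda>v. inner (Dh1 y) v)) (at y)"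
    and Dh1_lip: "locally_lipschitz Dh1"
    and h2_convex: "convex_on UNIV h2"
begin

definition ratio :: "'a \<Rightarrow> real" where "ratio y = f y / g y"

definition objective :: "'a \<Rightarrow> real" where "objective y = (f y)\<^sup>2 / g y + h1 y - h2 y"

text \<open>The objective with \<open>h2\<close> linearised at \<open>p\<close>. For
  \<open>z\<close> in \<open>subgrads UNIV h2 p\<close> and feasible \<open>y\<close> it equals
  \<open>H (y, z, ratio y)\<close>.\<close>

definition surrogate :: "'a \<Rightarrow> 'a \<Rightarrow> 'a \<Rightarrow> real" where
  "surrogate p z y = (f y)\<^sup>2 / g y + h1 y - inner (y - p) z - h2 p"

text \<open>Gradient at \<open>x\<close> of the smooth part of \<open>H\<close>, with
  \<open>c\<close> frozen at \<open>ratio x\<close>.\<close>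

definition direction :: "'a \<Rightarrow> 'a \<Rightarrow> 'a" where
  "direction x z = Dh1 x - (ratio x)\<^sup>2 *\<^sub>R Dg x - z"

lemma f_continuous: "continuous_on UNIV f"
  using convex_imp_continuous[OF f_convex] .

lemma h2_continuous: "continuous_on UNIV h2"
  using convex_imp_continuous[OF h2_convex] .

lemma g_continuous: "continuous_on UNIV g"
  by (auto simp: continuous_on_eq_continuous_at intro: has_derivative_continuous g_grad)

lemma h1_continuous: "continuous_on UNIV h1"
  by (auto simp: continuous_on_eq_continuous_at intro: has_derivative_continuous h1_grad)

lemma ratio_nonneg: "0 \<le> ratio y"
  by (simp add: ratio_def f_nonneg g_nonneg)

lemma continuous_on_ratio: "S \<subseteq> Omega g \<Longrightarrow> continuous_on S ratio"
  unfolding ratio_def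
  by (intro continuous_on_divide continuous_on_subset[OF f_continuous] continuous_on_subset[OF g_continuous])
    (auto simp: Omega_def)

lemma continuous_on_objective: "S \<subseteq> Omega g \<Longrightarrow> continuous_on S objective"
  unfolding objective_def
  by (intro continuous_on_divide continuous_on_add continuous_on_diff continuous_on_power
      continuous_on_subset[OF f_continuous] continuous_on_subset[OF g_continuous]
      continuous_on_subset[OF h1_continuous] continuous_on_subset[OF h2_continuous])
    (auto simp: Omega_def)

lemma Ffun_eq: "y \<in> Omega g \<inter> C \<Longrightarrow> Ffun f g h1 h2 C y = ereal (objective y)"
  by (simp add: Ffun_def objective_def)

text \<open>At \<open>c = f/g\<close> the quadratic \<open>2cf - c\<^sup>2g\<close> in
  \<open>c\<close> attains its maximum \<open>f\<^sup>2/g\<close>.\<close>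

lemma Hfun_eq_surrogate:
  assumes "y \<in> Omega g \<inter> C" "z \<in> subgrads UNIV h2 p"
  shows "Hfun f g h1 h2 C (y, z, ratio y) = ereal (surrogate p z y)"
proof -
  have "2 * ratio y * f y - (ratio y)\<^sup>2 * g y = (f y)\<^sup>2 / g y"
    using assms by (simp add: Omega_def ratio_def power2_eq_square field_simps)
  then show ?thesis
    using assms by (simp add: Hfun_def indicator_plus_def conjugate_subgrad[OF assms(2)]
        surrogate_def inner_diff_left)
qed

text \<open>\<open>h2\<close> lies above its linearisation at \<open>p\<close> and enters with a
  minus sign.\<close>

lemma objective_le_surrogate:
  assumes "z \<in> subgrads UNIV h2 p"
  shows "objective y \<le> surrogate p z y"
  using subgradsD[OF assms, of y] by (simp add: objective_def surrogate_def inner_commute)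

abbreviation prox_point :: "'a \<Rightarrow> 'a \<Rightarrow> real \<Rightarrow> 'a \<Rightarrow> bool" where
  "prox_point x z \<alpha> y \<equiv> y \<in> prox (indicator_plus C (\<lambda>w. 2 * \<alpha> * ratio x * f w)) (x - \<alpha> *\<^sub>R direction x z)"

lemma prox_point_subgrad:
  assumes "prox_point x z \<alpha> y" "0 < \<alpha>"
  shows "y \<in> C" "(1 / \<alpha>) *\<^sub>R (x - y) - direction x z \<in> subgrads C (\<lambda>w. 2 * ratio x * f w) y"
  using prox_step_subgrad[OF f_convex C_convex ratio_nonneg assms(2,1)] by auto

lemma compact_bounds:
  assumes X: "compact X" "X \<subseteq> Omega g \<inter> C"
  obtains R K L where "0 \<le> R" "0 < K" "0 < L"
    "\<And>x. x \<in> X \<Longrightarrow> norm x \<le> R \<and> f x \<le> K \<and> 1 / g x \<le> K \<and> ratio x \<le> K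
        \<and> norm (Dg x) \<le> K \<and> norm (Dh1 x) \<le> K"
    "\<And>x u. x \<in> X \<Longrightarrow> u \<in> subgrads UNIV f x \<union> subgrads UNIV h2 x \<Longrightarrow> norm u \<le> K"
    "\<And>x y. norm x \<le> R + 1 \<Longrightarrow> norm y \<le> R + 1 \<Longrightarrow> \<bar>f y - f x\<bar> \<le> L * norm (y - x)
        \<and> norm (Dg y - Dg x) \<le> L * norm (y - x) \<and> norm (Dh1 y - Dh1 x) \<le> L * norm (y - x)"
proof -
  have Om: "X \<subseteq> Omega g" using X by blast
  obtain R where R: "0 \<le> R" "\<And>x. x \<in> X \<Longrightarrow> norm x \<le> R"
    using continuous_on_compact_bound[OF X(1) continuous_on_id] by auto
  obtain K1 where K1: "0 \<le> K1" "\<And>x. x \<in> X \<Longrightarrow> norm (f x) \<le> K1"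
    using continuous_on_compact_bound[OF X(1) continuous_on_subset[OF f_continuous subset_UNIV]] by blast
  have "continuous_on X (\<lambda>x. 1 / g x)"
    using Om by (intro continuous_on_divide continuous_on_const continuous_on_subset[OF g_continuous])
      (auto simp: Omega_def)
  then obtain K2 where K2: "0 \<le> K2" "\<And>x. x \<in> X \<Longrightarrow> norm (1 / g x) \<le> K2"
    using continuous_on_compact_bound[OF X(1)] by blast
  obtain K3 where K3: "0 \<le> K3" "\<And>x. x \<in> X \<Longrightarrow> norm (ratio x) \<le> K3"
    using continuous_on_compact_bound[OF X(1) continuous_on_ratio[OF Om]] by blast
  obtain K4 where K4: "0 \<le> K4" "\<And>x. x \<in> X \<Longrightarrow> norm (Dg x) \<le> K4"
    using continuous_on_compact_bound[OF X(1) continuous_on_subset[OF locally_lipschitz_continuous[OF Dg_lip] subset_UNIV]]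
    by blast
  obtain K5 where K5: "0 \<le> K5" "\<And>x. x \<in> X \<Longrightarrow> norm (Dh1 x) \<le> K5"
    using continuous_on_compact_bound[OF X(1) continuous_on_subset[OF locally_lipschitz_continuous[OF Dh1_lip] subset_UNIV]]
    by blast
  obtain K6 where K6: "K6 > 0" "\<And>x u. norm x \<le> R \<Longrightarrow> u \<in> subgrads UNIV f x \<Longrightarrow> norm u \<le> K6"
    by (rule subgrads_bounded[OF f_convex, where R = R]) blast
  obtain K7 where K7: "K7 > 0" "\<And>x u. norm x \<le> R \<Longrightarrow> u \<in> subgrads UNIV h2 x \<Longrightarrow> norm u \<le> K7"
    by (rule subgrads_bounded[OF h2_convex, where R = R]) blast
  obtain L1 where L1: "L1 > 0"
    "\<And>x y. norm x \<le> R + 1 \<Longrightarrow> norm y \<le> R + 1 \<Longrightarrow> \<bar>f x - f y\<bar> \<le> L1 * norm (x - y)"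
    by (rule convex_lipschitz_bounded[OF f_convex, where R = "R + 1"]) blast
  obtain L2 where L2: "L2 > 0"
    "\<And>x y. norm x \<le> R + 1 \<Longrightarrow> norm y \<le> R + 1 \<Longrightarrow> dist (Dg x) (Dg y) \<le> L2 * dist x y"
    by (rule locally_lipschitz_bounded[OF Dg_lip, where R = "R + 1"]) blast
  obtain L3 where L3: "L3 > 0"
    "\<And>x y. norm x \<le> R + 1 \<Longrightarrow> norm y \<le> R + 1 \<Longrightarrow> dist (Dh1 x) (Dh1 y) \<le> L3 * dist x y"
    by (rule locally_lipschitz_bounded[OF Dh1_lip, where R = "R + 1"]) blast
  define K where "K = K1 + K2 + K3 + K4 + K5 + K6 + K7"
  define L where "L = L1 + L2 + L3"
  show thesis
  proof (rule that[of R K L])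
    show "0 \<le> R" "0 < K" "0 < L" using R K1 K2 K3 K4 K5 K6 K7 L1 L2 L3 by (auto simp: K_def L_def)
    show "norm x \<le> R \<and> f x \<le> K \<and> 1 / g x \<le> K \<and> ratio x \<le> K \<and> norm (Dg x) \<le> K \<and> norm (Dh1 x) \<le> K"
      if "x \<in> X" for x
      using R(2)[OF that] K1(1) K2(1) K3(1) K4(1) K5(1) K6(1) K7(1) K1(2)[OF that] K2(2)[OF that]
        K3(2)[OF that] K4(2)[OF that] K5(2)[OF that]
      unfolding K_def real_norm_def abs_le_iff by linarith
    show "norm u \<le> K" if "x \<in> X" "u \<in> subgrads UNIV f x \<union> subgrads UNIV h2 x" for x u
      using K6(2)[OF R(2), of x u] K7(2)[OF R(2), of x u] that K1(1) K2(1) K3(1) K4(1) K5(1) K6(1) K7(1)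
      unfolding K_def by (auto intro: order_trans)
    fix x y :: 'a assume xy: "norm x \<le> R + 1" "norm y \<le> R + 1"
    have le: "Li * norm (y - x) \<le> L * norm (y - x)" if "Li \<le> L" for Li
      using that by (intro mult_right_mono) auto
    show "\<bar>f y - f x\<bar> \<le> L * norm (y - x)
        \<and> norm (Dg y - Dg x) \<le> L * norm (y - x) \<and> norm (Dh1 y - Dh1 x) \<le> L * norm (y - x)"
      using L1(2)[OF xy(2,1)] L2(2)[OF xy(2,1)] L3(2)[OF xy(2,1)] le[of L1] le[of L2] le[of L3]
        L1(1) L2(1) L3(1)
      by (auto simp: L_def dist_norm)
  qed
qed

end

text \<open>The constants are fixed once and shared by all estimates. The Lipschitz bounds reach
  radius \<open>R + 1\<close> because trial points of the line search may leave
  \<open>X\<close>.\<close>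

locale fractional_program_compact = fractional_program +
  fixes X :: "'a set" and R K L :: real
  assumes X_sub: "X \<subseteq> Omega g \<inter> C"
    and R: "0 \<le> R" and K: "0 < K" and L: "0 < L"
    and bnd: "x \<in> X \<Longrightarrow> norm x \<le> R \<and> f x \<le> K \<and> 1 / g x \<le> K \<and> ratio x \<le> K
        \<and> norm (Dg x) \<le> K \<and> norm (Dh1 x) \<le> K"
    and subgrad_bnd: "x \<in> X \<Longrightarrow> u \<in> subgrads UNIV f x \<union> subgrads UNIV h2 x \<Longrightarrow> norm u \<le> K"
    and lip: "norm x \<le> R + 1 \<Longrightarrow> norm y \<le> R + 1 \<Longrightarrow> \<bar>f y - f x\<bar> \<le> L * norm (y - x)
        \<and> norm (Dg y - Dg x) \<le> L * norm (y - x) \<and> norm (Dh1 y - Dh1 x) \<le> L * norm (y - x)"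
begin

section \<open>Estimates uniform over the compact set\<close>

lemma g_pos: "x \<in> X \<Longrightarrow> 0 < g x"
  using X_sub g_nonneg[of x] by (force simp: Omega_def)

lemma ratio_mult: "x \<in> X \<Longrightarrow> ratio x * g x = f x"
  using g_pos[of x] by (simp add: ratio_def)

lemma g_descent: "norm x \<le> R + 1 \<Longrightarrow> norm y \<le> R + 1 \<Longrightarrow>
    \<bar>g y - g x - inner (Dg x) (y - x)\<bar> \<le> L * (norm (y - x))\<^sup>2"
  using lip L by (intro gradient_descent_bound[where R = "R + 1"] g_grad) (auto simp: dist_norm)

lemma h1_descent: "norm x \<le> R + 1 \<Longrightarrow> norm y \<le> R + 1 \<Longrightarrow>
    \<bar>h1 y - h1 x - inner (Dh1 x) (y - x)\<bar> \<le> L * (norm (y - x))\<^sup>2"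
  using lip L by (intro gradient_descent_bound[where R = "R + 1"] h1_grad) (auto simp: dist_norm)

text \<open>A Lipschitz constant for \<open>g\<close>: the gradient bound on \<open>X\<close> plus
  the quadratic remainder, one factor of which is at most the diameter
  \<open>2 * R + 2\<close>.\<close>

definition Lg :: real where "Lg = K + L * (2 * R + 2)"

lemma Lg_pos: "0 < Lg"
  using K L R by (simp add: Lg_def add_pos_pos)

lemma g_lipschitz:
  assumes x: "x \<in> X" and y: "norm y \<le> R + 1"
  shows "\<bar>g y - g x\<bar> \<le> Lg * norm (y - x)"
proof -
  have x': "norm x \<le> R + 1" using bnd[OF x] by simp
  have "norm (y - x) \<le> 2 * R + 2" using norm_triangle_ineq4[of y x] x' y by simp
  then have "L * (norm (y - x))\<^sup>2 \<le> L * (2 * R + 2) * norm (y - x)"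
    using L by (simp add: power2_eq_square mult_right_mono)
  moreover have "\<bar>inner (Dg x) (y - x)\<bar> \<le> K * norm (y - x)"
    using Cauchy_Schwarz_ineq2[of "Dg x" "y - x"] bnd[OF x]
    by (meson mult_right_mono norm_ge_zero order_trans)
  ultimately show ?thesis
    using g_descent[OF x' y] by (simp add: Lg_def distrib_right)
qed

text \<open>\<open>f - ratio x * g\<close> vanishes at \<open>x\<close>, so only increments of
  \<open>f\<close> and \<open>g\<close> remain.\<close>

lemma f_minus_ratio_g:
  assumes x: "x \<in> X" and y: "norm y \<le> R + 1"
  shows "\<bar>f y - ratio x * g y\<bar> \<le> (L + K * Lg) * norm (y - x)"
proof -
  have x': "norm x \<le> R + 1" using bnd[OF x] by simp
  have "f y - ratio x * g y = (f y - f x) - ratio x * (g y - g x)"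
    using ratio_mult[OF x] by (simp add: algebra_simps)
  also have "\<bar>\<dots>\<bar> \<le> \<bar>f y - f x\<bar> + ratio x * \<bar>g y - g x\<bar>"
    using abs_triangle_ineq4[of "f y - f x" "ratio x * (g y - g x)"] ratio_nonneg[of x] by (simp add: abs_mult)
  also have "\<dots> \<le> L * norm (y - x) + K * (Lg * norm (y - x))"
    using lip[OF x' y] g_lipschitz[OF x y] bnd[OF x] K by (intro add_mono mult_mono) auto
  finally show ?thesis by (simp add: algebra_simps)
qed

lemma ratio_lipschitz:
  assumes x: "x \<in> X" and y: "y \<in> X"
  shows "\<bar>ratio y - ratio x\<bar> \<le> K * (L + K * Lg) * norm (y - x)"
proof -
  have y': "norm y \<le> R + 1" using bnd[OF y] by simp
  have "ratio y - ratio x = (1 / g y) * (f y - ratio x * g y)"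
    using g_pos[OF y] by (simp add: ratio_def field_simps)
  also have "\<bar>\<dots>\<bar> = (1 / g y) * \<bar>f y - ratio x * g y\<bar>"
    using g_pos[OF y] by (simp add: abs_mult)
  also have "\<dots> \<le> K * ((L + K * Lg) * norm (y - x))"
    using f_minus_ratio_g[OF x y'] bnd[OF y] K by (intro mult_mono) auto
  finally show ?thesis by simp
qed

text \<open>The identity \<open>f\<^sup>2/g = 2cf - c\<^sup>2g + (f - cg)\<^sup>2/g\<close> linearises the quotient up to a
  second-order error, since \<open>f - cg\<close> vanishes at \<open>x\<close> for \<open>c = ratio x\<close>.\<close>
lemma quotient_upper_model:
  obtains \<delta> T where "0 < \<delta>" "0 \<le> T"
    "\<And>x y. x \<in> X \<Longrightarrow> norm (y - x) \<le> \<delta> \<Longrightarrow> 0 < g y \<and>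
      (f y)\<^sup>2 / g y + h1 y \<le> (f x)\<^sup>2 / g x + h1 x + 2 * ratio x * (f y - f x)
        + inner (Dh1 x - (ratio x)\<^sup>2 *\<^sub>R Dg x) (y - x) + T * (norm (y - x))\<^sup>2"
proof -
  \<comment> \<open>The bound 1 keeps \<open>y\<close> in the ball of radius \<open>R + 1\<close>;
    the other keeps \<open>g y\<close> above \<open>1 / (2 * K)\<close>, half the lower bound for
    \<open>g\<close> on \<open>X\<close>.\<close>
  define \<delta> where "\<delta> = min 1 (1 / (2 * K * Lg))"
  define E where "E = 2 * K * (L + K * Lg)\<^sup>2"
  have Epos: "0 \<le> E" using K by (simp add: E_def)
  show thesis
  proof (rule that[of \<delta> "E + K\<^sup>2 * L + L"])
    show "0 < \<delta>" using K Lg_pos by (simp add: \<delta>_def)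
    show "0 \<le> E + K\<^sup>2 * L + L" using Epos L by simp
    fix x y assume x: "x \<in> X" and y: "norm (y - x) \<le> \<delta>"
    let ?d = "norm (y - x)" and ?c = "ratio x"
    have d: "?d \<le> 1" "?d \<le> 1 / (2 * K * Lg)" using y by (auto simp: \<delta>_def)
    have x': "norm x \<le> R + 1" using bnd[OF x] by simp
    have y': "norm y \<le> R + 1" using norm_triangle_ineq2[of y x] d(1) bnd[OF x] by simp
    have gx: "1 / K \<le> g x" using bnd[OF x] g_pos[OF x] K by (simp add: field_simps)
    have "Lg * ?d \<le> Lg * (1 / (2 * K * Lg))" using d(2) Lg_pos by (intro mult_left_mono) auto
    also have "\<dots> = 1 / (2 * K)" using Lg_pos by simp
    finally have "Lg * ?d \<le> 1 / (2 * K)" .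
    then have gy: "1 / (2 * K) \<le> g y" using g_lipschitz[OF x y'] gx by (simp add: field_simps abs_le_iff)
    moreover have "0 < 1 / (2 * K)" using K by simp
    ultimately have gy0: "0 < g y" by linarith
    have "(f y)\<^sup>2 / g y - (2 * ?c * f y - ?c\<^sup>2 * g y) = (f y - ?c * g y)\<^sup>2 * (1 / g y)"
      using gy0 by (simp add: power2_eq_square field_simps)
    also have "\<dots> \<le> ((L + K * Lg) * ?d)\<^sup>2 * (2 * K)"
    proof (rule mult_mono)
      show "(f y - ?c * g y)\<^sup>2 \<le> ((L + K * Lg) * ?d)\<^sup>2"
        using f_minus_ratio_g[OF x y'] by (metis abs_ge_zero power2_abs power_mono)
      show "1 / g y \<le> 2 * K" using gy gy0 K by (simp add: field_simps)
    qed (use gy0 in auto)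
    also have "\<dots> = E * ?d\<^sup>2" by (simp add: E_def power_mult_distrib)
    finally have 1: "(f y)\<^sup>2 / g y \<le> 2 * ?c * f y - ?c\<^sup>2 * g y + E * ?d\<^sup>2" by simp
    \<comment> \<open>\<open>g\<close> enters with factor \<open>- ?c\<^sup>2\<close>, so the lower
      side of its descent estimate counts.\<close>
    have "?c\<^sup>2 * \<bar>g y - g x - inner (Dg x) (y - x)\<bar> \<le> K\<^sup>2 * (L * ?d\<^sup>2)"
      using g_descent[OF x' y'] bnd[OF x] ratio_nonneg[of x] by (intro mult_mono power_mono) auto
    moreover have "?c\<^sup>2 * - (g y - g x - inner (Dg x) (y - x)) \<le> ?c\<^sup>2 * \<bar>g y - g x - inner (Dg x) (y - x)\<bar>"
      by (intro mult_left_mono) auto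
    ultimately have "?c\<^sup>2 * - (g y - g x - inner (Dg x) (y - x)) \<le> K\<^sup>2 * (L * ?d\<^sup>2)" by linarith
    then have 2: "- ?c\<^sup>2 * g y \<le> - ?c\<^sup>2 * g x - ?c\<^sup>2 * inner (Dg x) (y - x) + K\<^sup>2 * L * ?d\<^sup>2"
      by (simp add: algebra_simps)
    have 3: "h1 y \<le> h1 x + inner (Dh1 x) (y - x) + L * ?d\<^sup>2"
      using h1_descent[OF x' y'] by (simp add: abs_le_iff)
    have 4: "(f x)\<^sup>2 / g x = 2 * ?c * f x - ?c\<^sup>2 * g x"
      using g_pos[OF x] by (simp add: ratio_def power2_eq_square field_simps)
    have "(f y)\<^sup>2 / g y + h1 y \<le> (f x)\<^sup>2 / g x + h1 x + 2 * ?c * (f y - f x)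
        + inner (Dh1 x - ?c\<^sup>2 *\<^sub>R Dg x) (y - x) + (E + K\<^sup>2 * L + L) * ?d\<^sup>2"
      using 1 2 3 unfolding 4 by (simp add: inner_diff_left algebra_simps)
    then show "0 < g y \<and> (f y)\<^sup>2 / g y + h1 y \<le> (f x)\<^sup>2 / g x + h1 x + 2 * ?c * (f y - f x)
        + inner (Dh1 x - ?c\<^sup>2 *\<^sub>R Dg x) (y - x) + (E + K\<^sup>2 * L + L) * ?d\<^sup>2"
      using gy0 by blast
  qed
qed

lemma direction_bound:
  assumes "x \<in> X" "z \<in> subgrads UNIV h2 x"
  shows "norm (direction x z) \<le> 2 * K + K ^ 3"
proof -
  have "norm (direction x z) \<le> norm (Dh1 x) + norm ((ratio x)\<^sup>2 *\<^sub>R Dg x) + norm z"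
    unfolding direction_def by (smt (verit) norm_triangle_ineq4)
  also have "norm ((ratio x)\<^sup>2 *\<^sub>R Dg x) \<le> K\<^sup>2 * K"
    using bnd[OF assms(1)] ratio_nonneg[of x] by (auto intro!: mult_mono power_mono)
  finally show ?thesis
    using bnd[OF assms(1)] subgrad_bnd[of x z] assms by (auto simp: power3_eq_cube power2_eq_square)
qed

text \<open>The subgradient inequality at \<open>y\<close> is tested at \<open>x\<close>. Comparing
  prox values directly would yield only half of the quadratic term.\<close>

lemma prox_point_decrease:
  assumes x: "x \<in> X" and y: "prox_point x z \<alpha> y" and \<alpha>: "0 < \<alpha>"
  shows "(norm (y - x))\<^sup>2 \<le> \<alpha> * - (2 * ratio x * (f y - f x) + inner (direction x z) (y - x))"
proof -
  have "x \<in> C" using x X_sub by blast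
  from subgradsD[OF prox_point_subgrad(2)[OF y \<alpha>] this]
  have "2 * ratio x * f y + ((1 / \<alpha>) * (norm (y - x))\<^sup>2 + inner (direction x z) (y - x)) \<le> 2 * ratio x * f x"
    by (simp add: inner_diff_left inner_diff_right power2_norm_eq_inner inner_commute algebra_simps)
  then have "(1 / \<alpha>) * (norm (y - x))\<^sup>2 \<le> - (2 * ratio x * (f y - f x) + inner (direction x z) (y - x))"
    by (simp add: algebra_simps)
  then have "\<alpha> * ((1 / \<alpha>) * (norm (y - x))\<^sup>2) \<le> \<alpha> * - (2 * ratio x * (f y - f x) + inner (direction x z) (y - x))"
    using \<alpha> by (intro mult_left_mono) auto
  then show ?thesis using \<alpha> by simp
qed

text \<open>A priori \<open>y\<close> may be far away, where no Lipschitz bound for \<open>f\<close>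
  is at hand; nonnegativity of \<open>f\<close> bounds the drop of \<open>ratio x * f\<close>
  instead.\<close>

lemma prox_point_close:
  assumes "0 < \<delta>"
  obtains a where "0 < a"
    "\<And>x z \<alpha> y. \<lbrakk>x \<in> X; z \<in> subgrads UNIV h2 x; 0 < \<alpha>; \<alpha> \<le> a; prox_point x z \<alpha> y\<rbrakk> \<Longrightarrow> norm (y - x) \<le> \<delta>"
proof -
  define V where "V = 2 * K + K ^ 3"
  define W where "W = V + 2 * K * K / \<delta>"
  have V: "0 < V" using K by (simp add: V_def add_pos_pos)
  have W: "0 < W" using K V assms by (simp add: W_def add_pos_pos)
  show thesis
  proof (rule that[of "\<delta> / W"])
    show "0 < \<delta> / W" using W assms by simp
    fix x z \<alpha> y assume x: "x \<in> X" and z: "z \<in> subgrads UNIV h2 x" and \<alpha>: "0 < \<alpha>" "\<alpha> \<le> \<delta> / W"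
      and y: "prox_point x z \<alpha> y"
    let ?d = "norm (y - x)"
    show "?d \<le> \<delta>"
    proof (rule ccontr)
      assume "\<not> ?d \<le> \<delta>"
      then have d: "\<delta> < ?d" by simp
      have "- inner (direction x z) (y - x) \<le> norm (direction x z) * ?d"
        using Cauchy_Schwarz_ineq2[of "direction x z" "y - x"] by (simp add: abs_le_iff)
      also have "\<dots> \<le> V * ?d"
        using direction_bound[OF x z] by (intro mult_right_mono) (auto simp: V_def)
      finally have 1: "- inner (direction x z) (y - x) \<le> V * ?d" .
      have "ratio x * f x \<le> K * K" using bnd[OF x] f_nonneg K by (intro mult_mono) auto
      moreover have "0 \<le> ratio x * f y" using ratio_nonneg f_nonneg by simp
      ultimately have "- (2 * ratio x * (f y - f x)) \<le> 2 * (K * K)" by (simp add: right_diff_distrib)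
      \<comment> \<open>Since \<open>\<delta> < ?d\<close>, the constant is absorbed into a term
        linear in \<open>?d\<close>, ready to cancel against \<open>?d\<^sup>2\<close>.\<close>
      also have "\<dots> = (2 * K * K / \<delta>) * \<delta>" using assms by simp
      also have "\<dots> \<le> (2 * K * K / \<delta>) * ?d" using d assms K by (intro mult_left_mono) auto
      finally have "- (2 * ratio x * (f y - f x) + inner (direction x z) (y - x)) \<le> W * ?d"
        using 1 by (simp add: W_def distrib_right)
      then have "\<alpha> * - (2 * ratio x * (f y - f x) + inner (direction x z) (y - x)) \<le> \<alpha> * (W * ?d)"
        using \<alpha> by (intro mult_left_mono) auto
      then have "?d\<^sup>2 \<le> \<alpha> * W * ?d" using prox_point_decrease[OF x y \<alpha>(1)] by (simp only: mult.assoc)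
      moreover have "0 < ?d" using d assms by linarith
      ultimately have "?d \<le> \<alpha> * W" by (simp add: power2_eq_square)
      also have "\<dots> \<le> \<delta>" using \<alpha> W by (simp add: field_simps)
      finally show False using d by simp
    qed
  qed
qed

text \<open>The prox step gains at least \<open>(norm (y - x))\<^sup>2 / \<alpha>\<close> in the
  model, whose error is \<open>T * (norm (y - x))\<^sup>2\<close>; for small \<open>\<alpha>\<close>
  the gain also pays for the \<open>\<sigma>\<close> term.\<close>

lemma line_search_succeeds:
  obtains a where "0 < a"
    "\<And>x z \<alpha> y. \<lbrakk>x \<in> X; z \<in> subgrads UNIV h2 x; 0 < \<alpha>; \<alpha> \<le> a; prox_point x z \<alpha> y\<rbrakk> \<Longrightarrow>
      y \<in> Omega g \<inter> C \<and> surrogate x z y + \<sigma> / 2 * (norm (y - x))\<^sup>2 \<le> objective x"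
proof -
  obtain \<delta> T where \<delta>T: "0 < \<delta>" "0 \<le> T"
    "\<And>x y. x \<in> X \<Longrightarrow> norm (y - x) \<le> \<delta> \<Longrightarrow> 0 < g y \<and>
      (f y)\<^sup>2 / g y + h1 y \<le> (f x)\<^sup>2 / g x + h1 x + 2 * ratio x * (f y - f x)
        + inner (Dh1 x - (ratio x)\<^sup>2 *\<^sub>R Dg x) (y - x) + T * (norm (y - x))\<^sup>2"
    by (rule quotient_upper_model) blast
  obtain a where a: "0 < a" "\<And>x z \<alpha> y. \<lbrakk>x \<in> X; z \<in> subgrads UNIV h2 x; 0 < \<alpha>; \<alpha> \<le> a; prox_point x z \<alpha> y\<rbrakk>
      \<Longrightarrow> norm (y - x) \<le> \<delta>"
    by (rule prox_point_close[OF \<delta>T(1)]) blast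
  \<comment> \<open>The sign of \<open>\<sigma>\<close> is arbitrary here; the absolute value and
    the 1 keep \<open>S\<close> positive.\<close>
  define S where "S = T + \<bar>\<sigma>\<bar> / 2 + 1"
  have S: "0 < S" using \<delta>T(2) by (simp add: S_def)
  show thesis
  proof (rule that[of "min a (1 / S)"])
    show "0 < min a (1 / S)" using a S by simp
    fix x z \<alpha> y
    assume x: "x \<in> X" and z: "z \<in> subgrads UNIV h2 x" and \<alpha>: "0 < \<alpha>" "\<alpha> \<le> min a (1 / S)"
      and y: "prox_point x z \<alpha> y"
    let ?d2 = "(norm (y - x))\<^sup>2" and ?m = "2 * ratio x * (f y - f x) + inner (direction x z) (y - x)"
    have "norm (y - x) \<le> \<delta>" using a(2)[OF x z \<alpha>(1) _ y] \<alpha> by simp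
    note model = \<delta>T(3)[OF x this]
    have "(\<alpha> * S) * ?d2 \<le> 1 * ?d2" using \<alpha> S by (intro mult_right_mono) (auto simp: field_simps)
    also have "1 * ?d2 \<le> \<alpha> * - ?m" using prox_point_decrease[OF x y \<alpha>(1)] by (simp only: mult_1)
    finally have "\<alpha> * (S * ?d2) \<le> \<alpha> * - ?m" by (simp only: mult.assoc)
    then have m: "S * ?d2 \<le> - ?m" using \<alpha> by (simp only: mult_le_cancel_left_pos)
    have s: "(T + \<sigma> / 2) * ?d2 \<le> S * ?d2" by (intro mult_right_mono) (auto simp: S_def)
    have "surrogate x z y + \<sigma> / 2 * ?d2 \<le> objective x + ?m + (T + \<sigma> / 2) * ?d2"
      using model by (simp add: surrogate_def objective_def direction_def inner_diff_left
          inner_commute[of _ z] algebra_simps)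
    also have "\<dots> \<le> objective x" using m s by linarith
    finally have "surrogate x z y + \<sigma> / 2 * ?d2 \<le> objective x" .
    then show "y \<in> Omega g \<inter> C \<and> surrogate x z y + \<sigma> / 2 * ?d2 \<le> objective x"
      using model prox_point_subgrad(1)[OF y \<alpha>(1)] by (auto simp: Omega_def)
  qed
qed

text \<open>\<open>\<mu> \<le> \<alpha>\<close> controls \<open>1 / \<alpha>\<close>; the rest of
  the subgradient consists of differences of Lipschitz quantities at \<open>x\<close> and
  \<open>y\<close>.\<close>

lemma subgradient_bound:
  assumes "0 < \<mu>"
  obtains b where
    "\<And>x z \<alpha> y. \<lbrakk>x \<in> X; y \<in> X; z \<in> subgrads UNIV h2 x; \<mu> \<le> \<alpha>; prox_point x z \<alpha> y\<rbrakk> \<Longrightarrow>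
      \<exists>v \<in> fsubdiff (Hfun f g h1 h2 C) (y, z, ratio y). norm v \<le> b * norm (y - x)"
proof -
  define Q where "Q = K * (L + K * Lg)"
  have Q: "0 < Q" using K L Lg_pos by (simp add: Q_def add_pos_pos)
  define b where "b = 1 / \<mu> + L + (K\<^sup>2 * L + 2 * K * Q * K) + 2 * Q * K + 1"
  show thesis
  proof (rule that[of b])
    fix x z \<alpha> y
    assume x: "x \<in> X" and y: "y \<in> X" and z: "z \<in> subgrads UNIV h2 x" and \<alpha>: "\<mu> \<le> \<alpha>"
      and prox: "prox_point x z \<alpha> y"
    have \<alpha>0: "0 < \<alpha>" using \<alpha> assms by simp
    let ?d = "norm (y - x)" and ?c = "ratio x" and ?c' = "ratio y"
    define u where "u = (1 / \<alpha>) *\<^sub>R (x - y) - direction x z"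
    have yC: "y \<in> C" and u: "u \<in> subgrads C (\<lambda>w. 2 * ?c * f w) y"
      using prox_point_subgrad[OF prox \<alpha>0] by (auto simp: u_def)
    \<comment> \<open>Only the \<open>f\<close> part of \<open>u\<close> carries the old
      coefficient; the normal part is kept.\<close>
    obtain \<xi> where \<xi>: "\<xi> \<in> subgrads UNIV f y" "u - (2 * ?c) *\<^sub>R \<xi> \<in> subgrads C (\<lambda>_. 0) y"
      by (rule subgrads_scaled_sum_rule[OF f_convex C_convex yC _ u]) (auto simp: ratio_nonneg)
    define u' where "u' = (2 * ?c') *\<^sub>R \<xi> + (u - (2 * ?c) *\<^sub>R \<xi>)"
    have u': "u' \<in> subgrads C (\<lambda>w. 2 * ?c' * f w) y"
      unfolding u'_def using ratio_nonneg by (intro subgrads_add_normal \<xi>) auto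
    define v where "v = u' - ?c'\<^sup>2 *\<^sub>R Dg y + Dh1 y - z"
    have "(v, x - y, 2 * f y - 2 * ?c' * g y) \<in> fsubdiff (Hfun f g h1 h2 C) (y, z, ?c')"
      unfolding v_def using f_continuous
      by (intro Hfun_fsubdiff g_grad h1_grad yC u' z) (simp add: continuous_on_eq_continuous_at)
    then have mem: "(v, x - y, 0) \<in> fsubdiff (Hfun f g h1 h2 C) (y, z, ?c')"
      using ratio_mult[OF y] by (simp add: mult.assoc)
    have xR: "norm x \<le> R + 1" and yR: "norm y \<le> R + 1" using bnd[OF x] bnd[OF y] by auto
    have c: "\<bar>?c' - ?c\<bar> \<le> Q * ?d" using ratio_lipschitz[OF x y] by (simp add: Q_def)
    \<comment> \<open>\<open>z\<close> cancels, and every summand vanishes when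
      \<open>y = x\<close>.\<close>
    have v: "v = (1 / \<alpha>) *\<^sub>R (x - y) + (Dh1 y - Dh1 x)
        - (?c'\<^sup>2 *\<^sub>R (Dg y - Dg x) + (?c'\<^sup>2 - ?c\<^sup>2) *\<^sub>R Dg x) + (2 * (?c' - ?c)) *\<^sub>R \<xi>"
      by (simp add: v_def u'_def u_def direction_def algebra_simps)
    have n1: "norm ((1 / \<alpha>) *\<^sub>R (x - y)) \<le> 1 / \<mu> * ?d"
      using \<alpha> assms \<alpha>0 by (simp add: norm_minus_commute frac_le)
    have n2: "norm (Dh1 y - Dh1 x) \<le> L * ?d" using lip[OF xR yR] by simp
    have n3: "norm (?c'\<^sup>2 *\<^sub>R (Dg y - Dg x)) \<le> K\<^sup>2 * (L * ?d)"
      using lip[OF xR yR] bnd[OF y] ratio_nonneg[of y] by (auto intro!: mult_mono power_mono)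
    have "?c'\<^sup>2 - ?c\<^sup>2 = (?c' + ?c) * (?c' - ?c)" by (simp add: power2_eq_square algebra_simps)
    then have "\<bar>?c'\<^sup>2 - ?c\<^sup>2\<bar> = (?c' + ?c) * \<bar>?c' - ?c\<bar>"
      using ratio_nonneg[of x] ratio_nonneg[of y] by (simp add: abs_mult)
    also have "\<dots> \<le> (2 * K) * (Q * ?d)"
      using c bnd[OF x] bnd[OF y] K by (intro mult_mono) auto
    finally have n4: "norm ((?c'\<^sup>2 - ?c\<^sup>2) *\<^sub>R Dg x) \<le> (2 * K) * (Q * ?d) * K"
      using bnd[OF x] K Q by (auto intro!: mult_mono)
    have n5: "norm ((2 * (?c' - ?c)) *\<^sub>R \<xi>) \<le> (2 * (Q * ?d)) * K"
      using c subgrad_bnd[OF y, of \<xi>] \<xi>(1) Q by (auto simp: abs_mult intro!: mult_mono)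
    have "norm v \<le> 1 / \<mu> * ?d + L * ?d + (K\<^sup>2 * (L * ?d) + (2 * K) * (Q * ?d) * K) + (2 * (Q * ?d)) * K"
      unfolding v by (intro norm_add_leD norm_triangle_mono norm_triangle_le_diff add_mono n1 n2 n3 n4 n5)
    moreover have "norm (v, x - y, 0::real) \<le> norm v + ?d"
      using norm_Pair_le[of v "(x - y, 0::real)"] by (simp add: norm_minus_commute norm_Pair)
    ultimately have "norm (v, x - y, 0::real) \<le> b * ?d" by (simp add: b_def algebra_simps)
    then show "\<exists>v \<in> fsubdiff (Hfun f g h1 h2 C) (y, z, ratio y). norm v \<le> b * norm (y - x)"
      using mem by blast
  qed
qed

end

section \<open>Runs with step sizes bounded below\<close>

section \<open>Convergence of the iterates\<close>

text \<open>The indices \<open>\<rho>\<close> need not increase strictly; divergence to infinity is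
  all that the limits require.\<close>

lemma cluster_point_cases:
  fixes w :: "nat \<Rightarrow> 'a::metric_space"
  obtains U where "open U" "p \<in> U" "\<forall>\<^sub>F k in sequentially. w k \<notin> U"
  | \<rho> where "filterlim \<rho> at_top sequentially" "(\<lambda>n. w (\<rho> n)) \<longlonglongrightarrow> p"
proof (cases "\<exists>U. open U \<and> p \<in> U \<and> (\<forall>\<^sub>F k in sequentially. w k \<notin> U)")
  case False
  have "\<exists>k\<ge>n. dist (w k) p < inverse (real (Suc n))" for n
  proof -
    have "\<not> (\<forall>\<^sub>F k in sequentially. w k \<notin> ball p (inverse (real (Suc n))))"
    proof
      assume "\<forall>\<^sub>F k in sequentially. w k \<notin> ball p (inverse (real (Suc n)))"
      moreover have "p \<in> ball p (inverse (real (Suc n)))" by simp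
      ultimately show False using False open_ball by blast
    qed
    then show ?thesis by (auto simp: eventually_sequentially dist_commute)
  qed
  then have "\<forall>n. \<exists>k. n \<le> k \<and> dist (w k) p < inverse (real (Suc n))" by blast
  from choice[OF this] obtain \<rho> where
    \<rho>: "\<And>n. n \<le> \<rho> n" "\<And>n. dist (w (\<rho> n)) p < inverse (real (Suc n))" by blast
  have "filterlim \<rho> at_top sequentially"
    unfolding filterlim_at_top eventually_sequentially using \<rho>(1) order_trans by blast
  moreover have "(\<lambda>n. dist (w (\<rho> n)) p) \<longlonglongrightarrow> 0"
  proof (rule Lim_null_comparison[OF always_eventually LIMSEQ_inverse_real_of_nat])
    show "\<forall>n. norm (dist (w (\<rho> n)) p) \<le> inverse (real (Suc n))"
      using \<rho>(2) by (simp add: less_imp_le)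
  qed
  then have "(\<lambda>n. w (\<rho> n)) \<longlonglongrightarrow> p" by (simp only: tendsto_dist_iff[symmetric])
  ultimately show thesis by (rule that(2))
next
  case True
  then obtain U where "open U" "p \<in> U" "\<forall>\<^sub>F k in sequentially. w k \<notin> U" by blast
  then show thesis by (rule that(1))
qed

text \<open>A run stripped of its backtracking: what remains is a lower bound on accepted step sizes
  and sufficient decrease.\<close>

locale fractional_program_run = fractional_program_compact +
  fixes \<sigma> \<mu> :: real and x z :: "nat \<Rightarrow> 'a" and \<alpha> :: "nat \<Rightarrow> real"
  assumes \<sigma>: "0 < \<sigma>" and \<mu>: "0 < \<mu>" and X_compact: "compact X"
    and xX: "x k \<in> X" and z: "z k \<in> subgrads UNIV h2 (x k)" and \<alpha>: "\<mu> \<le> \<alpha> k"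
    and prox: "prox_point (x k) (z k) (\<alpha> k) (x (Suc k))"
    and decrease: "surrogate (x k) (z k) (x (Suc k)) + \<sigma> / 2 * (norm (x (Suc k) - x k))\<^sup>2 \<le> objective (x k)"
begin

definition step :: "nat \<Rightarrow> real" where "step k = norm (x (Suc k) - x k)"

text \<open>The new iterate is paired with the old \<open>z k\<close>, which puts the value of
  \<open>H\<close> between two consecutive objective values.\<close>

definition state :: "nat \<Rightarrow> 'a \<times> 'a \<times> real" where "state k = (x (Suc k), z k, ratio (x (Suc k)))"

definition level :: real where "level = lim (\<lambda>k. objective (x k))"

definition gap :: "nat \<Rightarrow> real" where "gap k = surrogate (x k) (z k) (x (Suc k)) - level"

lemma objective_le: "objective (x (Suc k)) \<le> surrogate (x k) (z k) (x (Suc k))"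
  by (rule objective_le_surrogate[OF z])

lemma decrease': "surrogate (x k) (z k) (x (Suc k)) + \<sigma> / 2 * (step k)\<^sup>2 \<le> objective (x k)"
  using decrease by (simp add: step_def)

lemma surrogate_le: "surrogate (x k) (z k) (x (Suc k)) \<le> objective (x k)"
proof -
  have "0 \<le> \<sigma> / 2 * (step k)\<^sup>2" using \<sigma> by simp
  then show ?thesis using decrease'[of k] by linarith
qed

lemma objective_decseq: "decseq (\<lambda>k. objective (x k))"
  by (rule decseq_SucI) (rule order_trans[OF objective_le surrogate_le])

lemma objective_tendsto: "(\<lambda>k. objective (x k)) \<longlonglongrightarrow> level"
proof -
  have "continuous_on X objective" using X_sub by (intro continuous_on_objective) auto
  then obtain B where B: "\<And>y. y \<in> X \<Longrightarrow> norm (objective y) \<le> B"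
    by (rule continuous_on_compact_bound[OF X_compact]) blast
  have "\<forall>k. - B \<le> objective (x k)"
  proof
    fix k show "- B \<le> objective (x k)" using B[OF xX[of k]] by simp
  qed
  then obtain l where "(\<lambda>k. objective (x k)) \<longlonglongrightarrow> l"
    using decseq_convergent[OF objective_decseq, of "- B"] by blast
  then show ?thesis unfolding level_def by (metis limI)
qed

lemma level_le: "level \<le> objective (x k)"
  by (rule decseq_ge[OF objective_decseq objective_tendsto])

lemma gap_nonneg: "0 \<le> gap k"
  using objective_le[of k] level_le[of "Suc k"] by (simp add: gap_def)

lemma gap_tendsto: "gap \<longlonglongrightarrow> 0"
proof -
  have "(\<lambda>k. objective (x k) - level) \<longlonglongrightarrow> 0"
    using objective_tendsto by (simp add: LIM_zero)
  moreover have "\<forall>k. norm (gap k) \<le> objective (x k) - level"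
    using gap_nonneg surrogate_le by (simp add: gap_def)
  ultimately show ?thesis by (rule Lim_null_comparison[OF always_eventually, rotated])
qed

lemma gap_decrease: "gap (Suc k) + \<sigma> / 2 * (step (Suc k))\<^sup>2 \<le> gap k"
  using decrease'[of "Suc k"] objective_le[of k] by (simp add: gap_def)

lemma step_tendsto: "step \<longlonglongrightarrow> 0"
proof -
  have "(\<lambda>k. objective (x k) - objective (x (Suc k))) \<longlonglongrightarrow> level - level"
    by (intro tendsto_diff objective_tendsto LIMSEQ_Suc)
  then have "(\<lambda>k. sqrt (2 / \<sigma> * (objective (x k) - objective (x (Suc k))))) \<longlonglongrightarrow> sqrt (2 / \<sigma> * (level - level))"
    by (intro tendsto_real_sqrt tendsto_mult tendsto_const)
  then have "(\<lambda>k. sqrt (2 / \<sigma> * (objective (x k) - objective (x (Suc k))))) \<longlonglongrightarrow> 0" by simp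
  moreover have "step k \<le> sqrt (2 / \<sigma> * (objective (x k) - objective (x (Suc k))))" for k
  proof (rule real_le_rsqrt)
    show "(step k)\<^sup>2 \<le> 2 / \<sigma> * (objective (x k) - objective (x (Suc k)))"
      using decrease'[of k] objective_le[of k] \<sigma> by (simp add: field_simps)
  qed
  then have "\<forall>k. norm (step k) \<le> sqrt (2 / \<sigma> * (objective (x k) - objective (x (Suc k))))"
    by (simp add: step_def)
  ultimately show ?thesis by (rule Lim_null_comparison[OF always_eventually, rotated])
qed

lemma Hfun_state: "Hfun f g h1 h2 C (state k) = ereal (level + gap k)"
  using Hfun_eq_surrogate[OF subsetD[OF X_sub xX] z] by (simp add: state_def gap_def)

lemma state_compact: "compact (X \<times> (cball 0 K :: 'a set) \<times> {0..K})"
  by (intro compact_Times X_compact compact_cball compact_Icc)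

lemma state_in: "state k \<in> X \<times> cball 0 K \<times> {0..K}"
  using xX bnd[OF xX] subgrad_bnd[OF xX UnI2[OF z], of k] ratio_nonneg by (simp add: state_def)

text \<open>Vanishing steps give \<open>x (\<rho> n)\<close> and \<open>x (Suc (\<rho> n))\<close>
  the same limit; continuity on \<open>X\<close> and closedness of the subgradient graph do the
  rest.\<close>

lemma cluster_point:
  assumes \<rho>: "filterlim \<rho> at_top sequentially" and lim: "(\<lambda>n. state (\<rho> n)) \<longlonglongrightarrow> (xs, zs, cs)"
  shows "xs \<in> X" "cs = ratio xs" "zs \<in> subgrads UNIV h2 xs" "objective xs = level"
    "(\<lambda>n. x (\<rho> n)) \<longlonglongrightarrow> xs" "(\<lambda>n. x (Suc (\<rho> n))) \<longlonglongrightarrow> xs" "(\<lambda>n. z (\<rho> n)) \<longlonglongrightarrow> zs"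
    "(\<lambda>n. ratio (x (\<rho> n))) \<longlonglongrightarrow> ratio xs"
proof -
  show x1: "(\<lambda>n. x (Suc (\<rho> n))) \<longlonglongrightarrow> xs"
    using tendsto_fst[OF lim] by (simp add: state_def)
  show z1: "(\<lambda>n. z (\<rho> n)) \<longlonglongrightarrow> zs"
    using tendsto_fst[OF tendsto_snd[OF lim]] by (simp add: state_def)
  have c1: "(\<lambda>n. ratio (x (Suc (\<rho> n)))) \<longlonglongrightarrow> cs"
    using tendsto_snd[OF tendsto_snd[OF lim]] by (simp add: state_def)
  have "(\<lambda>n. step (\<rho> n)) \<longlonglongrightarrow> 0" using step_tendsto \<rho> by (rule filterlim_compose)
  then have "(\<lambda>n. x (Suc (\<rho> n)) - x (\<rho> n)) \<longlonglongrightarrow> 0"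
    unfolding step_def by (rule tendsto_norm_zero_cancel)
  then show x0: "(\<lambda>n. x (\<rho> n)) \<longlonglongrightarrow> xs"
    using tendsto_diff[OF x1, of "\<lambda>n. x (Suc (\<rho> n)) - x (\<rho> n)" 0] by simp
  show xs: "xs \<in> X"
    using closed_sequentially[OF compact_imp_closed[OF X_compact] _ x0] xX by blast
  have cont: "(\<lambda>n. \<phi> (y n)) \<longlonglongrightarrow> \<phi> xs"
    if "continuous_on X \<phi>" "y \<longlonglongrightarrow> xs" "\<And>n. y n \<in> X" for \<phi> :: "'a \<Rightarrow> real" and y
    using continuous_on_tendsto_compose[OF that(1,2) xs] that(3) by simp
  have Om: "X \<subseteq> Omega g" using X_sub by blast
  show r0: "(\<lambda>n. ratio (x (\<rho> n))) \<longlonglongrightarrow> ratio xs"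
    by (rule cont[OF continuous_on_ratio[OF Om] x0 xX])
  show "cs = ratio xs"
    by (rule LIMSEQ_unique[OF c1 cont[OF continuous_on_ratio[OF Om] x1 xX]])
  show "objective xs = level"
    by (rule LIMSEQ_unique[OF cont[OF continuous_on_objective[OF Om] x0 xX]
          filterlim_compose[OF objective_tendsto \<rho>]])
  show "zs \<in> subgrads UNIV h2 xs"
    by (rule subgrads_closed[where \<phi>s = "\<lambda>_. h2", OF z1 x0 _ tendsto_const z])
      (rule cont[OF continuous_on_subset[OF h2_continuous subset_UNIV] x0 xX])
qed

lemma state_subgradient:
  "\<exists>b v. \<forall>k. v k \<in> fsubdiff (Hfun f g h1 h2 C) (state k) \<and> norm (v k) \<le> b * step k"
proof -
  obtain b where b: "\<And>x z \<alpha> y. \<lbrakk>x \<in> X; y \<in> X; z \<in> subgrads UNIV h2 x; \<mu> \<le> \<alpha>; prox_point x z \<alpha> y\<rbrakk> \<Longrightarrow>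
      \<exists>v \<in> fsubdiff (Hfun f g h1 h2 C) (y, z, ratio y). norm v \<le> b * norm (y - x)"
    by (rule subgradient_bound[OF \<mu>]) blast
  have "\<exists>v. v \<in> fsubdiff (Hfun f g h1 h2 C) (state k) \<and> norm v \<le> b * step k" for k
    using b[OF xX xX z \<alpha> prox] unfolding state_def step_def by blast
  then have "\<exists>v. \<forall>k. v k \<in> fsubdiff (Hfun f g h1 h2 C) (state k) \<and> norm (v k) \<le> b * step k"
    by (intro choice) blast
  then show ?thesis by blast
qed

text \<open>All cluster points carry the value \<open>level\<close>, so \<open>gap\<close> is the
  excess over each of them, and their nonempty subdifferentials make KL available.\<close>

lemma cluster_point_subdiff:
  assumes \<rho>: "filterlim \<rho> at_top sequentially" and lim: "(\<lambda>n. state (\<rho> n)) \<longlonglongrightarrow> p"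
  shows "Hfun f g h1 h2 C p = ereal level" "0 \<in> lsubdiff (Hfun f g h1 h2 C) p"
proof -
  obtain xs zs cs where p: "p = (xs, zs, cs)" using prod_cases3 by blast
  note cl = cluster_point[OF \<rho> lim[unfolded p]]
  have "surrogate xs zs xs = objective xs" by (simp add: surrogate_def objective_def)
  then show Hp: "Hfun f g h1 h2 C p = ereal level"
    using Hfun_eq_surrogate[OF subsetD[OF X_sub cl(1)] cl(3)] cl(2,4) by (simp add: p)
  obtain b v where v: "\<And>k. v k \<in> fsubdiff (Hfun f g h1 h2 C) (state k)" "\<And>k. norm (v k) \<le> b * step k"
    using state_subgradient by blast
  have "(\<lambda>k. b * step k) \<longlonglongrightarrow> b * 0" by (intro tendsto_mult tendsto_const step_tendsto)
  then have "v \<longlonglongrightarrow> 0" using Lim_null_comparison[OF always_eventually[OF allI[OF v(2)]]] by simp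
  then have "(\<lambda>n. v (\<rho> n)) \<longlonglongrightarrow> 0" using \<rho> by (rule filterlim_compose)
  moreover have "(\<lambda>k. level + gap k) \<longlonglongrightarrow> level + 0" by (intro tendsto_add tendsto_const gap_tendsto)
  then have "(\<lambda>k. Hfun f g h1 h2 C (state k)) \<longlonglongrightarrow> Hfun f g h1 h2 C p"
    by (simp add: Hp Hfun_state)
  then have "(\<lambda>n. Hfun f g h1 h2 C (state (\<rho> n))) \<longlonglongrightarrow> Hfun f g h1 h2 C p"
    using \<rho> by (rule filterlim_compose)
  ultimately show "0 \<in> lsubdiff (Hfun f g h1 h2 C) p"
    unfolding lsubdiff_def mem_Collect_eq
    by (intro conjI exI[of _ "\<lambda>n. state (\<rho> n)"] exI[of _ "\<lambda>n. v (\<rho> n)"] allI lim v(1))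
      (simp_all add: Hp)
qed

text \<open>A point is either eventually avoided or a cluster point, where KL applies; compactness
  joins the cases.\<close>

lemma KL_along_states:
  assumes KL: "KL_function (Hfun f g h1 h2 C)"
  shows "KL_along (X \<times> cball 0 K \<times> {0..K}) state gap (\<lambda>k. infdist 0 (lsubdiff (Hfun f g h1 h2 C) (state k)))"
proof (rule KL_along_compact[OF state_compact infdist_nonneg])
  let ?d = "\<lambda>k. infdist 0 (lsubdiff (Hfun f g h1 h2 C) (state k))"
  fix p
  show "\<exists>U. open U \<and> p \<in> U \<and> KL_along U state gap ?d"
  proof (rule cluster_point_cases[of p state])
    fix U assume "open U" "p \<in> U" "\<forall>\<^sub>F k in sequentially. state k \<notin> U"
    then show ?thesis using KL_along_avoided by blast
  next
    fix \<rho> assume \<rho>: "filterlim \<rho> at_top sequentially" "(\<lambda>n. state (\<rho> n)) \<longlonglongrightarrow> p"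
    note p = cluster_point_subdiff[OF \<rho>]
    obtain v where v: "\<And>k. v k \<in> fsubdiff (Hfun f g h1 h2 C) (state k)"
      using state_subgradient by blast
    have "KL_at (Hfun f g h1 h2 C) p" using KL p(2) unfolding KL_function_def by blast
    then obtain a U \<psi> \<psi>' where des: "desingularizing a \<psi> \<psi>'" and U: "open U" "p \<in> U"
      and ineq: "\<And>w. \<lbrakk>w \<in> U; Hfun f g h1 h2 C p < Hfun f g h1 h2 C w; Hfun f g h1 h2 C w < Hfun f g h1 h2 C p + ereal a;
        lsubdiff (Hfun f g h1 h2 C) w \<noteq> {}\<rbrakk>
       \<Longrightarrow> 1 \<le> \<psi>' (real_of_ereal (Hfun f g h1 h2 C w - Hfun f g h1 h2 C p)) * infdist 0 (lsubdiff (Hfun f g h1 h2 C) w)"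
      by (rule KL_at_desingularizing) blast
    \<comment> \<open>\<open>v k\<close> rules out an empty subdifferential, about which KL says
      nothing.\<close>
    have "1 \<le> \<psi>' (gap k) * ?d k" if "state k \<in> U" "0 < gap k" "gap k < a" for k
      using ineq[of "state k"] that fsubdiff_subset_lsubdiff v[of k] by (auto simp: p(1) Hfun_state)
    then have "KL_along U state gap ?d"
      unfolding KL_along_def using des by (blast intro: always_eventually)
    then show ?thesis using U by blast
  qed
qed

lemma convergent_iterates:
  assumes "KL_function (Hfun f g h1 h2 C)"
  shows "convergent x"
proof -
  obtain b v where v: "\<And>k. v k \<in> fsubdiff (Hfun f g h1 h2 C) (state k)" "\<And>k. norm (v k) \<le> b * step k"
    using state_subgradient by blast
  let ?d = "\<lambda>k. infdist 0 (lsubdiff (Hfun f g h1 h2 C) (state k))"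
  have d: "?d (Suc k) \<le> b * step (Suc k)" for k
  proof (rule infdist_le2)
    show "v (Suc k) \<in> lsubdiff (Hfun f g h1 h2 C) (state (Suc k))"
      using v(1) fsubdiff_subset_lsubdiff by blast
    show "dist 0 (v (Suc k)) \<le> b * step (Suc k)" using v(2) by simp
  qed
  have s: "0 < \<sigma> / 2" and nn: "0 \<le> step (Suc k)" for k using \<sigma> by (auto simp: step_def)
  \<comment> \<open>Shifted by one: \<open>gap k\<close> belongs to \<open>x (Suc k)\<close>, so the
    decrease to \<open>gap (Suc k)\<close> involves \<open>step (Suc k)\<close>.\<close>
  have "summable (\<lambda>k. step (Suc k))"
    by (rule KL_finite_length[where h = gap and d = ?d, OF gap_decrease s gap_nonneg gap_tendsto
          nn d KL_along_states[OF assms] state_in])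
  then have "summable step" by (simp only: summable_Suc_iff)
  then show ?thesis unfolding step_def [abs_def] by (rule convergent_if_summable_steps)
qed

text \<open>\<open>z\<close> need not converge, so prox optimality passes to the limit along a
  subsequence of states; \<open>\<mu> \<le> \<alpha> k\<close> makes the scaled steps
  vanish.\<close>

lemma limit_critical:
  assumes "x \<longlonglongrightarrow> xs"
  shows "critical_point f g h1 h2 Dg Dh1 C xs"
proof -
  have all: "\<forall>k. state k \<in> X \<times> cball 0 K \<times> {0..K}" using state_in by blast
  obtain p \<rho> where \<rho>: "strict_mono \<rho>" and lim: "(state \<circ> \<rho>) \<longlonglongrightarrow> p"
    using seq_compactE[OF compact_imp_seq_compact[OF state_compact] all] by blast
  have \<rho>': "filterlim \<rho> at_top sequentially" using \<rho> by (rule filterlim_subseq)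
  obtain y zs cs where p: "p = (y, zs, cs)" using prod_cases3 by blast
  note cl = cluster_point[OF \<rho>' lim[unfolded p comp_def]]
  have "y = xs" using LIMSEQ_unique[OF cl(5) filterlim_compose[OF assms \<rho>']] .
  note cl = cl[unfolded this]
  let ?c = "ratio xs"
  let ?u = "\<lambda>k. (1 / \<alpha> k) *\<^sub>R (x k - x (Suc k)) - direction (x k) (z k)"
  have \<alpha>0: "0 < \<alpha> k" for k using \<alpha>[of k] \<mu> by linarith
  have u: "?u k \<in> subgrads C (\<lambda>w. 2 * ratio (x k) * f w) (x (Suc k))" for k
    using prox_point_subgrad(2)[OF prox \<alpha>0] .
  have "(\<lambda>k. (1 / \<alpha> k) *\<^sub>R (x k - x (Suc k))) \<longlonglongrightarrow> 0"
  proof (rule Lim_null_comparison[OF always_eventually])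
    have "(\<lambda>k. (1 / \<mu>) * step k) \<longlonglongrightarrow> (1 / \<mu>) * 0" by (intro tendsto_mult tendsto_const step_tendsto)
    then show "(\<lambda>k. (1 / \<mu>) * step k) \<longlonglongrightarrow> 0" by simp
    show "\<forall>k. norm ((1 / \<alpha> k) *\<^sub>R (x k - x (Suc k))) \<le> (1 / \<mu>) * step k"
    proof
      fix k
      have "norm ((1 / \<alpha> k) *\<^sub>R (x k - x (Suc k))) = (1 / \<alpha> k) * step k"
        using \<alpha>0[of k] by (simp add: step_def norm_minus_commute)
      also have "\<dots> \<le> (1 / \<mu>) * step k"
        using \<alpha> \<mu> by (intro mult_right_mono frac_le) (auto simp: step_def)
      finally show "norm ((1 / \<alpha> k) *\<^sub>R (x k - x (Suc k))) \<le> (1 / \<mu>) * step k" .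
    qed
  qed
  then have t0: "(\<lambda>n. (1 / \<alpha> (\<rho> n)) *\<^sub>R (x (\<rho> n) - x (Suc (\<rho> n)))) \<longlonglongrightarrow> 0"
    using \<rho>' by (rule filterlim_compose)
  have D: "(\<lambda>n. D (x (\<rho> n))) \<longlonglongrightarrow> D xs" if "locally_lipschitz D" for D :: "'a \<Rightarrow> 'a"
    using continuous_on_tendsto_compose[OF locally_lipschitz_continuous[OF that] cl(5)] by simp
  have "(\<lambda>n. ?u (\<rho> n)) \<longlonglongrightarrow> 0 - direction xs zs"
    unfolding direction_def
    by (intro tendsto_diff t0 tendsto_scaleR tendsto_power D Dg_lip Dh1_lip cl)
  moreover have "(\<lambda>n. 2 * ratio (x (\<rho> n)) * f (x (Suc (\<rho> n)))) \<longlonglongrightarrow> 2 * ?c * f xs"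
    using continuous_on_tendsto_compose[OF f_continuous cl(6)]
    by (intro tendsto_mult tendsto_const cl) simp
  \<comment> \<open>The coefficient of \<open>f\<close> still depends on \<open>n\<close>, hence
    closedness with varying functions.\<close>
  ultimately have "0 - direction xs zs \<in> subgrads C (\<lambda>w. 2 * ?c * f w) xs"
    by (rule subgrads_closed[where \<phi>s = "\<lambda>n w. 2 * ratio (x (\<rho> n)) * f w", OF _ cl(6)])
      (intro tendsto_mult tendsto_const cl u)+
  moreover have "xs \<in> Omega g \<inter> C" using cl(1) X_sub by blast
  moreover have "zs \<in> lsubdiff (\<lambda>w. ereal (h2 w)) xs"
    using cl(3) by (simp add: lsubdiff_convex[OF h2_convex])
  ultimately show ?thesis
    using subgrads_subset_lsubdiff[of xs C "\<lambda>w. 2 * ?c * f w"]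
    unfolding critical_point_def Let_def ratio_def[symmetric]
    by (intro conjI bexI[of _ "0 - direction xs zs"] bexI[of _ zs])
      (auto simp: direction_def)
qed

end

section \<open>Reduction of the algorithm to such a run\<close>

theorem theorem5p1:
  fixes f g h1 h2 :: "real^'n \<Rightarrow> real"
    and Dg Dh1 :: "real^'n \<Rightarrow> real^'n"
    and C :: "(real^'n) set"
    and alo ahi \<sigma> r :: real
    and x0 :: "real^'n"
    and x :: "nat \<Rightarrow> real^'n"
  assumes f_nonneg: "\<forall>y. 0 \<le> f y"
    and g_nonneg: "\<forall>y. 0 \<le> g y"
    and C_closed: "closed C" and C_convex: "convex C"
    and C_Omega: "C \<inter> Omega g \<noteq> {}"
    and f_convex: "convex_on UNIV f"
    and g_grad: "\<forall>y. (g has_derivative (\<lambda>v. inner (Dg y) v)) (at y)"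
    and Dg_lip: "locally_lipschitz Dg"
    and h1_grad: "\<forall>y. (h1 has_derivative (\<lambda>v. inner (Dh1 y) v)) (at y)"
    and Dh1_lip: "locally_lipschitz Dh1"
    and h2_convex: "convex_on UNIV h2"
    and params: "0 < alo" "alo < ahi" "0 < \<sigma>" "0 < r" "r < 1"
    and x0_dom: "Ffun f g h1 h2 C x0 \<noteq> \<infinity>"
    and X0_compact: "compact {y. Ffun f g h1 h2 C y \<noteq> \<infinity> \<and> Ffun f g h1 h2 C y \<le> Ffun f g h1 h2 C x0}"
    and H_proper: "proper_fun (Hfun f g h1 h2 C)"
    and H_closed: "closed_fun (Hfun f g h1 h2 C)"
    and H_KL: "KL_function (Hfun f g h1 h2 C)"
    and alg: "alg1_seq f g h1 h2 Dg Dh1 C alo ahi \<sigma> r x0 x"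
  shows "\<exists>xs. x \<longlonglongrightarrow> xs \<and> critical_point f g h1 h2 Dg Dh1 C xs"
proof -
  interpret fractional_program f g h1 h2 Dg Dh1 C
    using assms by unfold_locales auto
  let ?H = "Hfun f g h1 h2 C" and ?F = "Ffun f g h1 h2 C"
  define X where "X = {y. ?F y \<noteq> \<infinity> \<and> ?F y \<le> ?F x0}"
  have x0: "x0 \<in> Omega g \<inter> C" using x0_dom by (auto simp: Ffun_def split: if_splits)
  \<comment> \<open>The sublevel set in terms of the real-valued objective, so that iterates can be
    followed in real arithmetic.\<close>
  have X_iff: "y \<in> X \<longleftrightarrow> y \<in> Omega g \<inter> C \<and> objective y \<le> objective x0" for y
    using Ffun_eq[OF x0] Ffun_eq[of y] by (cases "y \<in> Omega g \<inter> C") (auto simp: X_def Ffun_def)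
  have X: "compact X" "X \<subseteq> Omega g \<inter> C" using X0_compact X_iff by (auto simp: X_def)
  define acc where "acc k z y \<longleftrightarrow> y \<in> Omega g \<and>
    ?H (y, z, f y / g y) + ereal (\<sigma> / 2 * (norm (y - x k))^2) \<le> ?F (x k)" for k z y
  have "\<forall>k. \<exists>z a0 j. z \<in> subgrads UNIV h2 (x k) \<and> alo \<le> a0 \<and>
      (\<forall>i<j. \<exists>y. prox_point (x k) z (r ^ i * a0) y \<and> \<not> acc k z y) \<and>
      prox_point (x k) z (r ^ j * a0) (x (Suc k)) \<and> acc k z (x (Suc k))"
    using alg unfolding alg1_seq_def Let_def lsubdiff_convex[OF h2_convex] acc_def direction_def ratio_def
    by meson
  then obtain z a0 j where z: "\<And>k. z k \<in> subgrads UNIV h2 (x k)" and a0: "\<And>k. alo \<le> a0 k"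
    and rej: "\<And>k i. i < j k \<Longrightarrow> \<exists>y. prox_point (x k) (z k) (r ^ i * a0 k) y \<and> \<not> acc k (z k) y"
    and prox: "\<And>k. prox_point (x k) (z k) (r ^ j k * a0 k) (x (Suc k))"
    and acc: "\<And>k. acc k (z k) (x (Suc k))"
    by metis
  have pos: "0 < r ^ i * a0 k" for i k
    using params a0[of k] by simp
  have acc_iff: "acc k (z k) y \<longleftrightarrow> surrogate (x k) (z k) y + \<sigma> / 2 * (norm (y - x k))^2 \<le> objective (x k)"
    if "x k \<in> Omega g \<inter> C" "y \<in> Omega g \<inter> C" for k y
    using that Hfun_eq_surrogate[OF that(2) z[of k]] by (simp add: acc_def Ffun_eq ratio_def)
  have decr: "surrogate (x k) (z k) (x (Suc k)) + \<sigma> / 2 * (norm (x (Suc k) - x k))^2 \<le> objective (x k)"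
    and SucOm: "x (Suc k) \<in> Omega g \<inter> C" if "x k \<in> Omega g \<inter> C" for k
  proof -
    show "x (Suc k) \<in> Omega g \<inter> C"
      using acc[of k] prox_point_subgrad(1)[OF prox pos] by (simp add: acc_def)
    then show "surrogate (x k) (z k) (x (Suc k)) + \<sigma> / 2 * (norm (x (Suc k) - x k))^2 \<le> objective (x k)"
      using acc_iff[OF that] acc by blast
  qed
  \<comment> \<open>Acceptance and \<open>objective_le_surrogate\<close> keep the iterates in the
    compact sublevel set.\<close>
  have xX: "x k \<in> X" for k
  proof (induction k)
    case 0
    have "x 0 = x0" using alg by (simp add: alg1_seq_def)
    then show ?case using x0 by (simp add: X_iff)
  next
    case (Suc k)
    then have k: "x k \<in> Omega g \<inter> C" "objective (x k) \<le> objective x0" by (auto simp: X_iff)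
    have "0 \<le> \<sigma> / 2 * (norm (x (Suc k) - x k))^2" using params by simp
    then have "objective (x (Suc k)) \<le> objective x0"
      using decr[OF k(1)] objective_le_surrogate[OF z[of k], of "x (Suc k)"] k(2) by linarith
    then show ?case using SucOm[OF k(1)] by (simp add: X_iff)
  qed
  then have xOm: "x k \<in> Omega g \<inter> C" for k using X(2) by blast
  show ?thesis
  proof (rule compact_bounds[OF X])
    fix R K L :: real
    assume "0 \<le> R" "0 < K" "0 < L"
      and "\<And>x. x \<in> X \<Longrightarrow> norm x \<le> R \<and> f x \<le> K \<and> 1 / g x \<le> K \<and> ratio x \<le> K
        \<and> norm (Dg x) \<le> K \<and> norm (Dh1 x) \<le> K"
      and "\<And>x u. x \<in> X \<Longrightarrow> u \<in> subgrads UNIV f x \<union> subgrads UNIV h2 x \<Longrightarrow> norm u \<le> K"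
      and "\<And>x y. norm x \<le> R + 1 \<Longrightarrow> norm y \<le> R + 1 \<Longrightarrow> \<bar>f y - f x\<bar> \<le> L * norm (y - x)
        \<and> norm (Dg y - Dg x) \<le> L * norm (y - x) \<and> norm (Dh1 y - Dh1 x) \<le> L * norm (y - x)"
    then interpret fractional_program_compact f g h1 h2 Dg Dh1 C X R K L
      using X(2) by unfold_locales
    obtain a where a: "0 < a"
      and ls: "\<And>x z \<alpha> y. \<lbrakk>x \<in> X; z \<in> subgrads UNIV h2 x; 0 < \<alpha>; \<alpha> \<le> a; prox_point x z \<alpha> y\<rbrakk> \<Longrightarrow>
        y \<in> Omega g \<inter> C \<and> surrogate x z y + \<sigma> / 2 * (norm (y - x))\<^sup>2 \<le> objective x"
      by (rule line_search_succeeds[where \<sigma> = \<sigma>]) blast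
    \<comment> \<open>Without backtracking the step is at least \<open>alo\<close>. Otherwise the
      last rejected trial exceeded \<open>a\<close>, and one reduction by \<open>r\<close> leaves at
      least \<open>r * a\<close>.\<close>
    have step: "min alo (r * a) \<le> r ^ j k * a0 k" for k
    proof (cases "j k")
      case 0 then show ?thesis using a0[of k] by simp
    next
      case (Suc i)
      then obtain y where y: "prox_point (x k) (z k) (r ^ i * a0 k) y" "\<not> acc k (z k) y"
        using rej[of i k] by auto
      have "\<not> r ^ i * a0 k \<le> a"
        using ls[OF xX z pos _ y(1)] acc_iff[OF xOm] y(2) by blast
      then have "r * a \<le> r * (r ^ i * a0 k)" using params by (intro mult_left_mono) auto
      then show ?thesis by (simp add: Suc mult.assoc min.coboundedI2)
    qed
    interpret fractional_program_run f g h1 h2 Dg Dh1 C X R K L \<sigma> "min alo (r * a)" x z "\<lambda>k. r ^ j k * a0 k"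
      using params a X(1) xX z step prox decr[OF xOm] by unfold_locales auto
    show ?thesis using convergent_iterates[OF H_KL] limit_critical unfolding convergent_def by blast
  qed
qed

end
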